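(* Let $n\ge1$, let $\mathrm Z_n$ and $\mathrm Z_{n+1}$ be the diagonal reduction algebras of $\mathfrak{gl}_n$ and $\mathfrak{gl}_{n+1}$, with multiplications $\diamond_{(n)}$ and $\diamond_{(n+1)}$, and let $\iota_n:\mathrm Z_n\to\mathrm Z_{n+1}$ be the natural embedding of double coset spaces. Let $\mathrm V_{n+1}$ be the left ideal of $\mathrm Z_{n+1}$ generated by $z_{i,n+1}$, $i=1,\dots,n$, and $\mathrm V'_{n+1}$ the right ideal of $\mathrm Z_{n+1}$ generated by $z_{n+1,i}$, $i=1,\dots,n$. Let $\pi_{n+1}:\mathrm Z_{n+1}\to\mathrm Z_{n+1}$ be any linear operator which projects $\mathrm Z_{n+1}$ onto $\iota_n(\mathrm Z_n)$ (its image is $\iota_n(\mathrm Z_n)$ and $\pi_{n+1}(x)=x$ for $x\in\iota_n(\mathrm Z_n)$) and such that $\pi_{n+1}(\mathrm V_{n+1})=0$ or $\pi_{n+1}(\mathrm V'_{n+1})=0$. Define $\tilde\diamond_{(n)}:\iota_n(\mathrm Z_n)\otimes\iota_n(\mathrm Z_n)\to\iota_n(\mathrm Z_n)$ as the composition $\tilde\diamond_{(n)}:=\pi_{n+1}\,\diamond_{(n+1)}$. Then $$\iota_n\,\diamond_{(n)}=\tilde\diamond_{(n)}\,(\iota_n\otimes\iota_n),$$ that is, $\iota_n(x\diamond_{(n)}y)=\pi_{n+1}\big(\iota_n(x)\diamond_{(n+1)}\iota_n(y)\big)$ for all $x,y\in\mathrm Z_n$.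
   Context: Algebra $\mathrm Z_n$. Let $\mathfrak g=\mathfrak{gl}_n\oplus\mathfrak{gl}_n$ over $\mathbb C$ with standard generators $E^{(1)}_{ij},E^{(2)}_{ij}$ of the two copies; put $e_{ij}:=E^{(1)}_{ij}+E^{(2)}_{ij}$, $E_{ij}:=E^{(1)}_{ij}-E^{(2)}_{ij}$. The $e_{ij}$ span the diagonal $\mathfrak k\simeq\mathfrak{gl}_n$: $[e_{ij},e_{kl}]=\delta_{jk}e_{il}-\delta_{il}e_{kj}$, $[e_{ij},E_{kl}]=\delta_{jk}E_{il}-\delta_{il}E_{kj}$, $[E_{ij},E_{kl}]=\delta_{jk}e_{il}-\delta_{il}e_{kj}$. $\mathfrak h$ is spanned by $h_a:=e_{aa}$, $\mathfrak n_+$ by $e_{ij}$ with $i<j$, $\mathfrak n_-$ by $e_{ij}$ with $i>j$. $\overline{\mathrm U}(\mathfrak h)$ is the localization of $\mathrm U(\mathfrak h)$ at the multiplicative set generated by $h_i-h_j+l$ ($i<j$, $l\in\mathbb Z$), and $\bar{\mathrm A}$ is the localization of $\mathrm A_n=\mathrm U(\mathfrak{gl}_n\oplus\mathfrak{gl}_n)$ at the same set. Then $\mathrm Z_n:=\bar{\mathrm A}/(\bar{\mathrm A}\mathfrak n_++\mathfrak n_-\bar{\mathrm A})$ with product $a\diamond b:=aPb$, where $P$ is the extremal projector of $\mathfrak k$: the unique formal series with constant term $1$ of zero-weight elements $\xi e_{-\gamma_1}\cdots e_{-\gamma_m}e_{\gamma'_1}\cdots e_{\gamma'_{m'}}$ ($\xi\in\overline{\mathrm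 U}(\mathfrak h)$, $\gamma_i,\gamma_j'$ positive roots, $e_{\pm\gamma}$ root vectors of $\mathfrak k$) with $\mathfrak n_+P=P\mathfrak n_-=0$, $P^2=P$. $z_{ij}\in\mathrm Z_n$ denotes the image of $E_{ij}$. Embedding $\iota_n$. The assignments $e_{ij}\mapsto e_{ij}$, $E_{ij}\mapsto E_{ij}$ ($i,j=1,\dots,n$) define an embedding $\mathfrak{gl}_n\oplus\mathfrak{gl}_n\to\mathfrak{gl}_{n+1}\oplus\mathfrak{gl}_{n+1}$ and of the (localized) enveloping algebras; it maps $\mathfrak n_\pm$ for $\mathfrak{gl}_n$ into $\mathfrak n_\pm$ for $\mathfrak{gl}_{n+1}$ and hence induces an embedding of double coset spaces $\iota_n:\mathrm Z_n\to\mathrm Z_{n+1}$ (not a homomorphism of algebras, since the projectors $P$ differ). *)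

theory Defs
  imports Complex_Main "HOL-Library.Poly_Mapping"
begin

section \<open>Free associative algebras over the complex numbers\<close>

datatype 'a word = Word (letters: "'a list")

instantiation word :: (type) monoid_add
begin

definition zero_word :: "'a word" where
  "0 = Word []"

definition plus_word :: "'a word \<Rightarrow> 'a word \<Rightarrow> 'a word" where
  "u + v = Word (letters u @ letters v)"

instance
  by standard (simp_all add: zero_word_def plus_word_def)

end

text \<open>With the monoid of words (written additively) as exponents, the convolution product of
  \<^typ>\<open>'a word \<Rightarrow>\<^sub>0 complex\<close> is the product of the free associative algebra.\<close>

type_synonym 'a free_alg = "'a word \<Rightarrow>\<^sub>0 complex"

definition var :: "'a \<Rightarrow> 'a free_alg" where
  "var x = Poly_Mapping.single (Word [x]) 1"

definition cst :: "complex \<Rightarrow> 'a free_alg" where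
  "cst c = Poly_Mapping.single 0 c"

definition free_map :: "('a \<Rightarrow> 'b) \<Rightarrow> 'a free_alg \<Rightarrow> 'b free_alg" where
  "free_map f x =
     (\<Sum>w\<in>Poly_Mapping.keys x. Poly_Mapping.single (map_word f w) (Poly_Mapping.lookup x w))"

lemma free_map_eq_sum:
  assumes "finite S" "Poly_Mapping.keys x \<subseteq> S"
  shows "free_map f x = (\<Sum>w\<in>S. Poly_Mapping.single (map_word f w) (Poly_Mapping.lookup x w))"
  unfolding free_map_def
  by (rule sum.mono_neutral_left) (use assms in \<open>auto simp: in_keys_iff\<close>)

lemma free_map_single: "free_map f (Poly_Mapping.single w c) = Poly_Mapping.single (map_word f w) c"
  by (cases "c = 0") (simp_all add: free_map_def)

lemma free_map_zero [simp]: "free_map f 0 = 0"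
  by (simp add: free_map_def)

lemma free_map_add: "free_map f (x + y) = free_map f x + free_map f y"
proof -
  let ?S = "Poly_Mapping.keys x \<union> Poly_Mapping.keys y"
  have "free_map f z = (\<Sum>w\<in>?S. Poly_Mapping.single (map_word f w) (Poly_Mapping.lookup z w))"
    if "Poly_Mapping.keys z \<subseteq> ?S" for z
    using that by (intro free_map_eq_sum) auto
  with keys_add[of x y] show ?thesis
    by (simp add: lookup_add single_add sum.distrib)
qed

lemma free_map_uminus: "free_map f (- x) = - free_map f x"
  using free_map_add[of f x "- x"] by (simp add: eq_neg_iff_add_eq_0 add.commute)

lemma free_map_diff: "free_map f (x - y) = free_map f x - free_map f y"
  using free_map_add[of f x "- y"] by (simp add: free_map_uminus)

lemma map_word_add: "map_word f (u + v) = map_word f u + map_word f v"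
  by (cases u; cases v) (simp add: plus_word_def)

lemma map_word_zero [simp]: "map_word f 0 = 0"
  by (simp add: zero_word_def)

lemma free_induct [case_names zero add]:
  fixes x :: "'a free_alg"
  assumes "Q 0" and "\<And>w c y. Q y \<Longrightarrow> Q (Poly_Mapping.single w c + y)"
  shows "Q x"
proof -
  have x: "x = (\<Sum>w\<in>Poly_Mapping.keys x. Poly_Mapping.single w (Poly_Mapping.lookup x w))"
    by (rule poly_mapping_eqI) (simp add: lookup_sum lookup_single when_def in_keys_iff)
  have "Q (\<Sum>w\<in>S. Poly_Mapping.single w (Poly_Mapping.lookup x w))" if "finite S" for S
    using that by induction (auto simp: assms)
  then show ?thesis
    using x by (metis finite_keys)
qed

lemma free_map_mult: "free_map f (x * y) = free_map f x * free_map f y"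
proof (induction x rule: free_induct)
  case (add u c x)
  have "free_map f (Poly_Mapping.single u c * y) = Poly_Mapping.single (map_word f u) c * free_map f y"
    by (induction y rule: free_induct)
       (simp_all add: distrib_left free_map_add mult_single free_map_single map_word_add)
  with add show ?case
    by (simp add: distrib_right free_map_add free_map_single)
qed simp

lemma free_map_cst [simp]: "free_map f (cst c) = cst c"
  by (simp add: cst_def free_map_single)

lemma free_map_one [simp]: "free_map f 1 = 1"
  using free_map_cst[of f 1] by (simp add: cst_def)

lemma free_map_var [simp]: "free_map f (var x) = var (f x)"
  by (simp add: var_def free_map_single)

lemma cst_one [simp]: "cst 1 = 1"
  and cst_add: "cst (b + c) = cst b + cst c"
  and cst_mult: "cst (b * c) = cst b * cst c"
  by (simp_all add: cst_def single_add mult_single)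

lemma cst_commute: "cst c * x = x * cst c"
  by (induction x rule: free_induct)
     (simp_all add: cst_def distrib_left distrib_right mult_single mult.commute)

inductive_set two_sided_ideal :: "'a::ring_1 set \<Rightarrow> 'a set" for R where
  base: "r \<in> R \<Longrightarrow> r \<in> two_sided_ideal R"
| zero: "0 \<in> two_sided_ideal R"
| add: "x \<in> two_sided_ideal R \<Longrightarrow> y \<in> two_sided_ideal R \<Longrightarrow> x + y \<in> two_sided_ideal R"
| left: "x \<in> two_sided_ideal R \<Longrightarrow> a * x \<in> two_sided_ideal R"
| right: "x \<in> two_sided_ideal R \<Longrightarrow> x * a \<in> two_sided_ideal R"

lemma two_sided_ideal_uminus: "x \<in> two_sided_ideal R \<Longrightarrow> - x \<in> two_sided_ideal R"
  using two_sided_ideal.left[of x R "-1"] by simp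

lemma two_sided_ideal_diff:
  "x \<in> two_sided_ideal R \<Longrightarrow> y \<in> two_sided_ideal R \<Longrightarrow> x - y \<in> two_sided_ideal R"
  using two_sided_ideal.add[of x R "- y"] by (simp add: two_sided_ideal_uminus)

lemma equivp_two_sided_ideal: "equivp (\<lambda>x y. x - y \<in> two_sided_ideal R)"
proof (rule equivpI)
  show "reflp (\<lambda>x y. x - y \<in> two_sided_ideal R)"
    by (simp add: reflp_def two_sided_ideal.zero)
  show "symp (\<lambda>x y. x - y \<in> two_sided_ideal R)"
    using two_sided_ideal_uminus by (fastforce simp: symp_def)
  show "transp (\<lambda>x y. x - y \<in> two_sided_ideal R)"
  proof (rule transpI)
    fix x y z assume "x - y \<in> two_sided_ideal R" "y - z \<in> two_sided_ideal R"
    from two_sided_ideal.add[OF this] show "x - z \<in> two_sided_ideal R" by simp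
  qed
qed

section \<open>The localized enveloping algebra\<close>

text \<open>The rank enters through a linearly ordered index type \<open>'n\<close>; a finite one with \<open>n\<close> elements
  is a copy of \<open>1 < \<dots> < n\<close>.  \<open>Gen1 i j\<close>, \<open>Gen2 i j\<close> are the matrix units of the two copies of
  \<open>gl\<^sub>n\<close>, and \<open>Inv i j l\<close> stands for the inverse of \<open>h\<^sub>i - h\<^sub>j + l\<close> when \<open>i < j\<close>.\<close>

datatype 'n gen = Gen1 'n 'n | Gen2 'n 'n | Inv 'n 'n int

definition comm :: "'a::ring \<Rightarrow> 'a \<Rightarrow> 'a" where
  "comm x y = x * y - y * x"

definition root_diff :: "'n \<Rightarrow> 'n \<Rightarrow> int \<Rightarrow> 'n gen free_alg" where
  "root_diff i j l =
     (var (Gen1 i i) + var (Gen2 i i)) - (var (Gen1 j j) + var (Gen2 j j)) + cst (of_int l)"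

text \<open>The first three families present the enveloping algebra of \<open>gl\<^sub>n \<oplus> gl\<^sub>n\<close>, the next two adjoin
  two-sided inverses universally.  The last family removes the meaningless symbols \<open>Inv i j l\<close>
  with \<open>\<not> i < j\<close>; it does not assert that anything is invertible.\<close>

inductive_set relators :: "'n::linorder gen free_alg set" where
  gl1: "comm (var (Gen1 i j)) (var (Gen1 k l))
          - ((if j = k then var (Gen1 i l) else 0) - (if i = l then var (Gen1 k j) else 0)) \<in> relators"
| gl2: "comm (var (Gen2 i j)) (var (Gen2 k l))
          - ((if j = k then var (Gen2 i l) else 0) - (if i = l then var (Gen2 k j) else 0)) \<in> relators"
| gl12: "comm (var (Gen1 i j)) (var (Gen2 k l)) \<in> relators"
| inv_right: "i < j \<Longrightarrow> root_diff i j l * var (Inv i j l) - 1 \<in> relators"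
| inv_left: "i < j \<Longrightarrow> var (Inv i j l) * root_diff i j l - 1 \<in> relators"
| inv_junk: "\<not> i < j \<Longrightarrow> var (Inv i j l) \<in> relators"

quotient_type (overloaded) 'n abar = "'n::linorder gen free_alg" /
  "\<lambda>x y. x - y \<in> two_sided_ideal relators"
  by (rule equivp_two_sided_ideal)

instantiation abar :: (linorder) "{ring, monoid_mult}"
begin

lift_definition zero_abar :: "'a abar" is 0 .
lift_definition one_abar :: "'a abar" is 1 .

lift_definition plus_abar :: "'a abar \<Rightarrow> 'a abar \<Rightarrow> 'a abar" is "(+)"
  by (simp add: add_diff_add two_sided_ideal.add)

lift_definition uminus_abar :: "'a abar \<Rightarrow> 'a abar" is uminus
  by (drule two_sided_ideal_uminus) simp

lift_definition minus_abar :: "'a abar \<Rightarrow> 'a abar \<Rightarrow> 'a abar" is "(-)"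
  by (drule (1) two_sided_ideal_diff) (simp add: algebra_simps)

lift_definition times_abar :: "'a abar \<Rightarrow> 'a abar \<Rightarrow> 'a abar" is "(*)"
proof -
  fix x x' y y' :: "'a gen free_alg"
  assume "x - x' \<in> two_sided_ideal relators" "y - y' \<in> two_sided_ideal relators"
  then have "(x - x') * y + x' * (y - y') \<in> two_sided_ideal relators"
    by (intro two_sided_ideal.add two_sided_ideal.left two_sided_ideal.right)
  then show "x * y - x' * y' \<in> two_sided_ideal relators"
    by (simp add: algebra_simps)
qed

instance
  by standard (transfer; simp add: algebra_simps two_sided_ideal.zero)+

end

lift_definition scaleA :: "complex \<Rightarrow> 'n::linorder abar \<Rightarrow> 'n abar" is "\<lambda>c x. cst c * x"
  by (simp flip: right_diff_distrib add: two_sided_ideal.left)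

global_interpretation abar: vector_space scaleA
  by standard
     (transfer; simp add: cst_add cst_mult algebra_simps two_sided_ideal.zero)+

lift_definition E1 :: "'n::linorder \<Rightarrow> 'n \<Rightarrow> 'n abar" is "\<lambda>i j. var (Gen1 i j)" .
lift_definition E2 :: "'n::linorder \<Rightarrow> 'n \<Rightarrow> 'n abar" is "\<lambda>i j. var (Gen2 i j)" .
lift_definition inv_root :: "'n::linorder \<Rightarrow> 'n \<Rightarrow> int \<Rightarrow> 'n abar" is "\<lambda>i j l. var (Inv i j l)" .

definition e_diag :: "'n::linorder \<Rightarrow> 'n \<Rightarrow> 'n abar" where
  "e_diag i j = E1 i j + E2 i j"

definition E_diff :: "'n::linorder \<Rightarrow> 'n \<Rightarrow> 'n abar" where
  "E_diff i j = E1 i j - E2 i j"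

definition h_diag :: "'n::linorder \<Rightarrow> 'n abar" where
  "h_diag a = e_diag a a"

inductive_set Uh :: "'n::linorder abar set" where
  one: "1 \<in> Uh"
| h: "h_diag a \<in> Uh"
| inv: "i < j \<Longrightarrow> inv_root i j l \<in> Uh"
| add: "x \<in> Uh \<Longrightarrow> y \<in> Uh \<Longrightarrow> x + y \<in> Uh"
| scale: "x \<in> Uh \<Longrightarrow> scaleA c x \<in> Uh"
| mult: "x \<in> Uh \<Longrightarrow> y \<in> Uh \<Longrightarrow> x * y \<in> Uh"

definition n_plus :: "'n::linorder abar set" where
  "n_plus = abar.span {e_diag i j |i j. i < j}"

definition n_minus :: "'n::linorder abar set" where
  "n_minus = abar.span {e_diag i j |i j. i > j}"

section \<open>The double coset space\<close>

definition coset_space :: "'n::linorder abar set" where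
  "coset_space = abar.span ({a * x |a x. x \<in> n_plus} \<union> {y * a |y a. y \<in> n_minus})"

quotient_type (overloaded) 'n dra = "'n::linorder abar" / "\<lambda>x y. x - y \<in> coset_space"
proof (rule equivpI)
  show "reflp (\<lambda>x y. x - y \<in> (coset_space :: 'n abar set))"
    by (simp add: reflp_def coset_space_def abar.span_zero)
  show "symp (\<lambda>x y. x - y \<in> (coset_space :: 'n abar set))"
    using abar.span_neg by (fastforce simp: symp_def coset_space_def)
  show "transp (\<lambda>x y. x - y \<in> (coset_space :: 'n abar set))"
  proof (rule transpI)
    fix x y z :: "'n abar" assume "x - y \<in> coset_space" "y - z \<in> coset_space"
    from abar.span_add[OF this[unfolded coset_space_def]] show "x - z \<in> coset_space"
      by (simp add: coset_space_def)
  qed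
qed

instantiation dra :: (linorder) ab_group_add
begin

lift_definition zero_dra :: "'a dra" is 0 .

lift_definition plus_dra :: "'a dra \<Rightarrow> 'a dra \<Rightarrow> 'a dra" is "(+)"
  by (simp add: add_diff_add coset_space_def abar.span_add)

lift_definition uminus_dra :: "'a dra \<Rightarrow> 'a dra" is uminus
  unfolding coset_space_def by (drule abar.span_neg) simp

lift_definition minus_dra :: "'a dra \<Rightarrow> 'a dra \<Rightarrow> 'a dra" is "(-)"
  unfolding coset_space_def by (drule (1) abar.span_diff) (simp add: algebra_simps)

instance
  by standard (transfer; simp add: algebra_simps coset_space_def abar.span_zero)+

end

lift_definition scaleZ :: "complex \<Rightarrow> 'n::linorder dra \<Rightarrow> 'n dra" is scaleA
  by (simp add: coset_space_def abar.span_scale flip: abar.scale_right_diff_distrib)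

global_interpretation dra: vector_space scaleZ
  by standard
     (transfer; simp add: abar.scale_right_distrib abar.scale_left_distrib coset_space_def
        abar.span_zero)+

definition to_dra :: "'n::linorder abar \<Rightarrow> 'n dra" where
  "to_dra = abs_dra"

definition z_gen :: "'n::linorder \<Rightarrow> 'n \<Rightarrow> 'n dra" where
  "z_gen i j = to_dra (E_diff i j)"

section \<open>The extremal projector and the product\<close>

text \<open>The pair \<open>(i, j)\<close> with \<open>i < j\<close> encodes the positive root \<open>\<epsilon>\<^sub>i - \<epsilon>\<^sub>j\<close>.\<close>

definition pos_roots :: "('n::linorder \<times> 'n) set" where
  "pos_roots = {(i, j). i < j}"

definition weight :: "('n \<times> 'n) list \<Rightarrow> 'n \<Rightarrow> int" where
  "weight \<gamma>s k = (\<Sum>(i, j)\<leftarrow>\<gamma>s. of_bool (k = i) - of_bool (k = j))"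

definition raising :: "('n::linorder \<times> 'n) list \<Rightarrow> 'n abar" where
  "raising \<gamma>s = prod_list (map (\<lambda>(i, j). e_diag i j) \<gamma>s)"

definition lowering :: "('n::linorder \<times> 'n) list \<Rightarrow> 'n abar" where
  "lowering \<gamma>s = prod_list (map (\<lambda>(i, j). e_diag j i) \<gamma>s)"

definition zero_weight_terms :: "nat \<Rightarrow> 'n::linorder abar set" where
  "zero_weight_terms d =
     {\<xi> * lowering \<gamma>s * raising \<gamma>s' |\<xi> \<gamma>s \<gamma>s'. \<xi> \<in> Uh \<and> set \<gamma>s \<subseteq> pos_roots \<and> set \<gamma>s' \<subseteq> pos_roots \<and>
        weight \<gamma>s = weight \<gamma>s' \<and> length \<gamma>s' = d}"

text \<open>For finite \<open>'n\<close>, only finitely many of the monomials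
  \<open>e\<^bsub>-\<gamma>\<^sub>1\<^esub> \<dots> e\<^bsub>-\<gamma>\<^sub>m\<^esub> e\<^bsub>\<gamma>'\<^sub>1\<^esub> \<dots> e\<^bsub>\<gamma>'\<^sub>d\<^esub>\<close> of zero weight have a given number \<open>d\<close> of
  raising factors.  So a formal series of such terms is a sequence \<open>P\<close> whose entry \<open>P d\<close> is the
  (finite) sum of the terms with \<open>d\<close> raising factors, standing for \<open>\<Sum>d. P d\<close>.  Only constants have
  zero weight and no raising factor, so \<open>P 0\<close> is the constant term.  Identities between formal
  series are identities in the completion with respect to the left ideals generated by the
  \<open>N\<close>-fold products of elements of \<open>n\<^sub>+\<close>.\<close>

definition formal_series :: "(nat \<Rightarrow> 'n::linorder abar) \<Rightarrow> bool" where
  "formal_series P \<longleftrightarrow> (\<forall>d. P d \<in> abar.span (zero_weight_terms d))"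

definition psum :: "(nat \<Rightarrow> 'n::linorder abar) \<Rightarrow> nat \<Rightarrow> 'n abar" where
  "psum P M = (\<Sum>d<M. P d)"

definition nplus_power_ideal :: "nat \<Rightarrow> 'n::linorder abar set" where
  "nplus_power_ideal N = abar.span {a * prod_list xs |a xs. set xs \<subseteq> n_plus \<and> length xs = N}"

definition tends_to_zero :: "(nat \<Rightarrow> 'n::linorder abar) \<Rightarrow> bool" where
  "tends_to_zero s \<longleftrightarrow> (\<forall>N. \<forall>\<^sub>F M in sequentially. s M \<in> nplus_power_ideal N)"

text \<open>The defining properties of the extremal projector, as a predicate.  By the theorem of Asherova,
  Smirnov and Tolstoy exactly one formal series has them, so "let \<open>P\<close> be the extremal projector"
  becomes the hypothesis \<open>extremal_projector P\<close>.\<close>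

definition extremal_projector :: "(nat \<Rightarrow> 'n::linorder abar) \<Rightarrow> bool" where
  "extremal_projector P \<longleftrightarrow>
     formal_series P \<and> P 0 = 1 \<and>
     (\<forall>x\<in>n_plus. tends_to_zero (\<lambda>M. x * psum P M)) \<and>
     (\<forall>y\<in>n_minus. tends_to_zero (\<lambda>M. psum P M * y)) \<and>
     tends_to_zero (\<lambda>M. psum P M * psum P M - psum P M)"

text \<open>The class of \<open>a P b\<close>: long raising monomials, moved to the right through \<open>b\<close>, end up in the
  left ideal generated by \<open>n\<^sub>+\<close>, so the classes of \<open>a * psum P M * b\<close> are eventually constant.\<close>

definition diamond :: "(nat \<Rightarrow> 'n::linorder abar) \<Rightarrow> 'n dra \<Rightarrow> 'n dra \<Rightarrow> 'n dra" where
  "diamond P x y =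
     (THE w. \<forall>a b. to_dra a = x \<longrightarrow> to_dra b = y \<longrightarrow>
        (\<forall>\<^sub>F M in sequentially. to_dra (a * psum P M * b) = w))"

inductive_set left_ideal :: "('n::linorder dra \<Rightarrow> 'n dra \<Rightarrow> 'n dra) \<Rightarrow> 'n dra set \<Rightarrow> 'n dra set"
  for m G where
  base: "g \<in> G \<Longrightarrow> g \<in> left_ideal m G"
| zero: "0 \<in> left_ideal m G"
| add: "x \<in> left_ideal m G \<Longrightarrow> y \<in> left_ideal m G \<Longrightarrow> x + y \<in> left_ideal m G"
| scale: "x \<in> left_ideal m G \<Longrightarrow> scaleZ c x \<in> left_ideal m G"
| mult: "x \<in> left_ideal m G \<Longrightarrow> m a x \<in> left_ideal m G"

inductive_set right_ideal :: "('n::linorder dra \<Rightarrow> 'n dra \<Rightarrow> 'n dra) \<Rightarrow> 'n dra set \<Rightarrow> 'n dra set"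
  for m G where
  base: "g \<in> G \<Longrightarrow> g \<in> right_ideal m G"
| zero: "0 \<in> right_ideal m G"
| add: "x \<in> right_ideal m G \<Longrightarrow> y \<in> right_ideal m G \<Longrightarrow> x + y \<in> right_ideal m G"
| scale: "x \<in> right_ideal m G \<Longrightarrow> scaleZ c x \<in> right_ideal m G"
| mult: "x \<in> right_ideal m G \<Longrightarrow> m x a \<in> right_ideal m G"

section \<open>The embedding\<close>

text \<open>\<open>'n plus1\<close> is the index type with one new largest index, so it has \<open>n + 1\<close> elements.\<close>

datatype 'n plus1 = Old 'n | Last

instantiation plus1 :: (linorder) linorder
begin

fun less_eq_plus1 :: "'a plus1 \<Rightarrow> 'a plus1 \<Rightarrow> bool" where
  "x \<le> Last \<longleftrightarrow> True"
| "Old i \<le> Old j \<longleftrightarrow> i \<le> j"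
| "Last \<le> Old j \<longleftrightarrow> False"

definition less_plus1 :: "'a plus1 \<Rightarrow> 'a plus1 \<Rightarrow> bool" where
  "(x :: 'a plus1) < y \<longleftrightarrow> x \<le> y \<and> \<not> y \<le> x"

instance
proof
  fix x y w :: "'a plus1"
  show "x < y \<longleftrightarrow> x \<le> y \<and> \<not> y \<le> x"
    by (rule less_plus1_def)
  show "x \<le> x"
    by (cases x) auto
  show "x \<le> y \<Longrightarrow> y \<le> w \<Longrightarrow> x \<le> w"
    by (cases x; cases y; cases w) auto
  show "x \<le> y \<Longrightarrow> y \<le> x \<Longrightarrow> x = y"
    by (cases x; cases y) auto
  show "x \<le> y \<or> y \<le> x"
    by (cases x; cases y) auto
qed

end

instance plus1 :: (finite) finite
proof
  have "(UNIV :: 'a plus1 set) = insert Last (range Old)"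
    by (auto intro: plus1.exhaust)
  then show "finite (UNIV :: 'a plus1 set)"
    by (metis finite finite_imageI finite_insert)
qed

lemma Old_less_iff [simp]: "Old i < Old j \<longleftrightarrow> i < j"
  by (auto simp: less_plus1_def)

lemma free_map_relators: "r \<in> relators \<Longrightarrow> free_map (map_gen Old) r \<in> relators"
proof (induction rule: relators.induct)
  case (gl1 i j k l)
  show ?case
    using relators.gl1[of "Old i" "Old j" "Old k" "Old l"]
    by (simp add: comm_def free_map_diff free_map_mult if_distrib[of "free_map _"] cong: if_cong)
next
  case (gl2 i j k l)
  show ?case
    using relators.gl2[of "Old i" "Old j" "Old k" "Old l"]
    by (simp add: comm_def free_map_diff free_map_mult if_distrib[of "free_map _"] cong: if_cong)
next
  case (gl12 i j k l)
  show ?case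
    using relators.gl12[of "Old i" "Old j" "Old k" "Old l"]
    by (simp add: comm_def free_map_diff free_map_mult)
next
  case (inv_right i j l)
  then show ?case
    using relators.inv_right[of "Old i" "Old j" l]
    by (simp add: root_diff_def free_map_diff free_map_add free_map_mult)
next
  case (inv_left i j l)
  then show ?case
    using relators.inv_left[of "Old i" "Old j" l]
    by (simp add: root_diff_def free_map_diff free_map_add free_map_mult)
next
  case (inv_junk i j l)
  then show ?case
    using relators.inv_junk[of "Old i" "Old j" l] by simp
qed

lemma free_map_ideal:
  "x \<in> two_sided_ideal relators \<Longrightarrow> free_map (map_gen Old) x \<in> two_sided_ideal relators"
  by (induction rule: two_sided_ideal.induct)
     (auto simp: free_map_add free_map_mult intro: two_sided_ideal.intros free_map_relators)

lift_definition emb :: "'n::linorder abar \<Rightarrow> 'n plus1 abar" is "free_map (map_gen Old)"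
  by (simp flip: free_map_diff add: free_map_ideal)

lemma emb_add: "emb (x + y) = emb x + emb y"
  by transfer (simp add: free_map_add two_sided_ideal.zero)

lemma emb_diff: "emb (x - y) = emb x - emb y"
  by transfer (simp add: free_map_diff two_sided_ideal.zero)

lemma emb_mult: "emb (x * y) = emb x * emb y"
  by transfer (simp add: free_map_mult two_sided_ideal.zero)

lemma emb_scale: "emb (scaleA c x) = scaleA c (emb x)"
  by transfer (simp add: free_map_mult two_sided_ideal.zero)

lemma emb_zero [simp]: "emb 0 = 0"
  using emb_diff[of 0 0] by simp

lemma emb_e: "emb (e_diag i j) = e_diag (Old i) (Old j)"
  unfolding e_diag_def emb_add by (transfer; simp add: two_sided_ideal.zero)

lemma emb_span:
  assumes "x \<in> abar.span S" "\<And>s. s \<in> S \<Longrightarrow> emb s \<in> abar.span T"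
  shows "emb x \<in> abar.span T"
  using assms(1)
  by (induction rule: abar.span_induct_alt)
     (auto simp: emb_add emb_scale abar.span_zero intro!: abar.span_add abar.span_scale assms(2))

lemma emb_n_plus: "x \<in> n_plus \<Longrightarrow> emb x \<in> n_plus"
  unfolding n_plus_def by (erule emb_span) (force simp: emb_e intro: abar.span_base)

lemma emb_n_minus: "x \<in> n_minus \<Longrightarrow> emb x \<in> n_minus"
  unfolding n_minus_def by (erule emb_span) (force simp: emb_e intro: abar.span_base)

lemma emb_coset_space: "x \<in> coset_space \<Longrightarrow> emb x \<in> coset_space"
  unfolding coset_space_def
  by (erule emb_span)
     (rule abar.span_base, elim UnE CollectE exE conjE,
      (use emb_mult emb_n_plus emb_n_minus in blast)+)

lift_definition iota :: "'n::linorder dra \<Rightarrow> 'n plus1 dra" is emb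
  by (simp flip: emb_diff add: emb_coset_space)

end

theory Submission
  imports Defs
begin

text \<open>Let \<open>L\<close> be the left ideal of the big algebra generated by the \<open>(i, n+1)\<close> matrix units of both
  copies, \<open>i \<le> n\<close>.  It is stable under right multiplication by the small algebra.  By zero weight
  every term of \<open>P'\<close> other than \<open>1\<close> lies in \<open>L\<close> or starts with a lowering operator of \<open>gl\<^sub>n\<close>, and
  the latter is killed by \<open>P\<close> from the left.  So \<open>P P' b\<close> and \<open>P b\<close> agree modulo \<open>L\<close>, while
  \<open>P P' = P'\<close> because every term of \<open>P\<close> other than \<open>1\<close> ends with a raising operator.  Hence
  \<open>a P' b - a P b\<close> lies in \<open>L\<close> up to the cosets, and by a triangularity argument the image of \<open>L\<close>
  in the double coset space is contained in \<open>V\<^sub>n\<^sub>+\<^sub>1\<close>.  The statement for \<open>V'\<^sub>n\<^sub>+\<^sub>1\<close> is the mirror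
  image, starting from \<open>P' P = P'\<close>.  Since \<open>P\<close> and \<open>P'\<close> are given by truncations, one of the two
  truncation indices is fixed first, large enough for an estimate uniform in the other.\<close>

section \<open>Calculus in the localized enveloping algebra\<close>

lemma scaleA_mult_left [simp]: "scaleA c x * y = scaleA c (x * y)"
  by transfer (simp add: mult.assoc two_sided_ideal.zero)

lemma scaleA_mult_right [simp]: "x * scaleA c y = scaleA c (x * y)"
proof transfer
  fix x y :: "'a gen free_alg" and c
  have "x * (cst c * y) = cst c * (x * y)"
    by (metis cst_commute mult.assoc)
  then show "x * (cst c * y) - cst c * (x * y) \<in> two_sided_ideal relators"
    by (simp add: two_sided_ideal.zero)
qed

lemma E1_E1: "E1 i j * E1 k l =
    E1 k l * E1 i j + ((if j = k then E1 i l else 0) - (if i = l then E1 k j else 0))"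
proof transfer
  fix i j k l :: 'a
  show "var (Gen1 i j) * var (Gen1 k l) - (var (Gen1 k l) * var (Gen1 i j) +
      ((if j = k then var (Gen1 i l) else 0) - (if i = l then var (Gen1 k j) else 0)))
      \<in> two_sided_ideal relators"
    using two_sided_ideal.base[OF relators.gl1[of i j k l]] by (simp add: comm_def diff_diff_eq)
qed

lemma E2_E2: "E2 i j * E2 k l =
    E2 k l * E2 i j + ((if j = k then E2 i l else 0) - (if i = l then E2 k j else 0))"
proof transfer
  fix i j k l :: 'a
  show "var (Gen2 i j) * var (Gen2 k l) - (var (Gen2 k l) * var (Gen2 i j) +
      ((if j = k then var (Gen2 i l) else 0) - (if i = l then var (Gen2 k j) else 0)))
      \<in> two_sided_ideal relators"
    using two_sided_ideal.base[OF relators.gl2[of i j k l]] by (simp add: comm_def diff_diff_eq)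
qed

lemma E1_E2: "E1 i j * E2 k l = E2 k l * E1 i j"
proof transfer
  fix i j k l :: 'a
  show "var (Gen1 i j) * var (Gen2 k l) - var (Gen2 k l) * var (Gen1 i j)
      \<in> two_sided_ideal relators"
    using two_sided_ideal.base[OF relators.gl12[of i j k l]] by (simp add: comm_def)
qed

definition root_diffA :: "'n::linorder \<Rightarrow> 'n \<Rightarrow> int \<Rightarrow> 'n abar" where
  "root_diffA i j l = h_diag i - h_diag j + scaleA (of_int l) 1"

lemma root_diffA_abs: "root_diffA i j l = abs_abar (root_diff i j l)"
proof -
  have "scaleA (of_int l) (1 :: 'a abar) = abs_abar (cst (of_int l))"
    by (simp add: scaleA.abs_eq one_abar.abs_eq)
  then show ?thesis
    by (simp add: root_diffA_def root_diff_def h_diag_def e_diag_def E1.abs_eq E2.abs_eq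
        plus_abar.abs_eq minus_abar.abs_eq)
qed

lemma root_diffA_inv:
  assumes "i < j"
  shows "root_diffA i j l * inv_root i j l = 1" "inv_root i j l * root_diffA i j l = 1"
  using two_sided_ideal.base[OF relators.inv_right[OF assms, of l]]
    two_sided_ideal.base[OF relators.inv_left[OF assms, of l]]
  by (simp_all add: root_diffA_abs inv_root.abs_eq times_abar.abs_eq one_abar.abs_eq abar.abs_eq_iff)

lemma inv_root_junk: "\<not> i < j \<Longrightarrow> inv_root i j l = 0"
  using two_sided_ideal.base[OF relators.inv_junk[of i j l]]
  by (simp add: inv_root.abs_eq zero_abar.abs_eq abar.abs_eq_iff)

lemma abs_abar_var: "abs_abar (var g) =
    (case g of Gen1 i j \<Rightarrow> E1 i j | Gen2 i j \<Rightarrow> E2 i j | Inv i j l \<Rightarrow> inv_root i j l)"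
  by (simp add: E1.abs_eq E2.abs_eq inv_root.abs_eq split: gen.split)

text \<open>The quotient map sends the free algebra onto linear combinations of products of
  generators, and the case of inverses may assume \<open>i < j\<close> because the other symbols
  vanish by \<open>inv_root_junk\<close>. Stability under multiplication by an arbitrary element is
  thereby reduced to generators.\<close>

lemma abar_induct [case_names E1 E2 inv one add scale mult]:
  fixes x :: "'n::linorder abar"
  assumes "\<And>i j. Q (E1 i j)" "\<And>i j. Q (E2 i j)" "\<And>i j l. i < j \<Longrightarrow> Q (inv_root i j l)" "Q 1"
    and add: "\<And>x y. Q x \<Longrightarrow> Q y \<Longrightarrow> Q (x + y)" and scale: "\<And>c x. Q x \<Longrightarrow> Q (scaleA c x)"
    and mult: "\<And>x y. Q x \<Longrightarrow> Q y \<Longrightarrow> Q (x * y)"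
  shows "Q x"
proof -
  have zero: "Q 0"
    using scale[of 1 0] assms(4) by simp
  have var: "Q (abs_abar (var g))" for g
    unfolding abs_abar_var using assms(1-3) zero
    by (auto split: gen.split) (metis inv_root_junk)
  have word: "Q (abs_abar (Poly_Mapping.single w 1))" for w
  proof (cases w)
    case (Word gs)
    have "Q (abs_abar (Poly_Mapping.single (Word gs) 1))"
    proof (induction gs)
      case Nil
      then show ?case
        using assms(4) by (simp add: one_abar.abs_eq flip: zero_word_def)
    next
      case (Cons g gs)
      have "abs_abar (Poly_Mapping.single (Word (g # gs)) 1) =
          abs_abar (var g) * abs_abar (Poly_Mapping.single (Word gs) 1)"
        by (simp add: times_abar.abs_eq var_def mult_single plus_word_def)
      with Cons show ?case
        using mult var by simp
    qed
    with Word show ?thesis by simp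
  qed
  have "Q (abs_abar f)" for f
  proof (induction f rule: free_induct)
    case zero
    then show ?case
      using \<open>Q 0\<close> by (simp add: zero_abar.abs_eq)
  next
    case (add w c f)
    have "abs_abar (Poly_Mapping.single w c + f) =
        scaleA c (abs_abar (Poly_Mapping.single w 1)) + abs_abar f"
      by (simp add: scaleA.abs_eq plus_abar.abs_eq cst_def mult_single)
    then show ?case
      using add word assms(5) scale by simp
  qed
  then show ?thesis
    by (induct x rule: abar.abs_induct)
qed

lemma span_mult_left: "x \<in> abar.span S \<Longrightarrow> (\<And>s. s \<in> S \<Longrightarrow> a * s \<in> abar.span T) \<Longrightarrow>
    a * x \<in> abar.span T"
  by (induction rule: abar.span_induct_alt)
     (auto simp: distrib_left abar.span_zero intro!: abar.span_add abar.span_scale)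

lemma span_mult_right: "x \<in> abar.span S \<Longrightarrow> (\<And>s. s \<in> S \<Longrightarrow> s * a \<in> abar.span T) \<Longrightarrow>
    x * a \<in> abar.span T"
  by (induction rule: abar.span_induct_alt)
     (auto simp: distrib_right abar.span_zero intro!: abar.span_add abar.span_scale)

lemma span_subspace_induct:
  "x \<in> abar.span S \<Longrightarrow> abar.subspace {x. Q x} \<Longrightarrow> (\<And>s. s \<in> S \<Longrightarrow> Q s) \<Longrightarrow> Q x"
  using abar.span_minimal[of S "{x. Q x}"] by auto

text \<open>Together with \<open>span_subspace_induct\<close> this lets a claim about
  \<open>a * x * b\<close> be checked on a spanning set for \<open>x\<close>.\<close>

lemma subspace_vimage_mult:
  "abar.subspace {x. Q x} \<Longrightarrow> abar.subspace {x. Q (a * x * b)}"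
  by (simp add: abar.subspace_def distrib_left distrib_right)

text \<open>The families \<open>E1\<close>, \<open>E2\<close>, \<open>e_diag\<close> and
  \<open>E_diff\<close> all transform like matrix units under the adjoint action of the diagonal
  subalgebra; one commutation argument then serves all of them.\<close>

definition adjoint_family :: "('n::linorder \<Rightarrow> 'n \<Rightarrow> 'n abar) \<Rightarrow> bool" where
  "adjoint_family F \<longleftrightarrow> (\<forall>a b k l. e_diag a b * F k l =
     F k l * e_diag a b + ((if b = k then F a l else 0) - (if a = l then F k b else 0)))"

lemma adjoint_family_E1: "adjoint_family E1"
  unfolding adjoint_family_def
proof (intro allI)
  fix a b k l :: 'a
  show "e_diag a b * E1 k l =
      E1 k l * e_diag a b + ((if b = k then E1 a l else 0) - (if a = l then E1 k b else 0))"
    by (simp add: e_diag_def distrib_left distrib_right E1_E1[of a b k l] E1_E2[of k l a b])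
qed

lemma adjoint_family_E2: "adjoint_family E2"
  unfolding adjoint_family_def
proof (intro allI)
  fix a b k l :: 'a
  show "e_diag a b * E2 k l =
      E2 k l * e_diag a b + ((if b = k then E2 a l else 0) - (if a = l then E2 k b else 0))"
    by (simp add: e_diag_def distrib_left distrib_right E2_E2[of a b k l] E1_E2[of a b k l])
qed

lemma adjoint_family_add:
  assumes "adjoint_family F" "adjoint_family G"
  shows "adjoint_family (\<lambda>i j. F i j + G i j)"
proof -
  have "e_diag a b * (F k l + G k l) = (F k l + G k l) * e_diag a b +
      ((if b = k then F a l + G a l else 0) - (if a = l then F k b + G k b else 0))" for a b k l
    using assms[unfolded adjoint_family_def, rule_format, of a b k l]
    by (simp add: distrib_left distrib_right)
  then show ?thesis
    by (simp add: adjoint_family_def)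
qed

lemma adjoint_family_diff:
  assumes "adjoint_family F" "adjoint_family G"
  shows "adjoint_family (\<lambda>i j. F i j - G i j)"
proof -
  have "e_diag a b * (F k l - G k l) = (F k l - G k l) * e_diag a b +
      ((if b = k then F a l - G a l else 0) - (if a = l then F k b - G k b else 0))" for a b k l
    using assms[unfolded adjoint_family_def, rule_format, of a b k l]
    by (simp add: left_diff_distrib right_diff_distrib)
  then show ?thesis
    by (simp add: adjoint_family_def)
qed

lemma adjoint_family_e_diag: "adjoint_family e_diag"
  using adjoint_family_add[OF adjoint_family_E1 adjoint_family_E2]
  by (simp add: e_diag_def[abs_def])

lemma adjoint_family_E_diff: "adjoint_family E_diff"
  using adjoint_family_diff[OF adjoint_family_E1 adjoint_family_E2]
  by (simp add: E_diff_def[abs_def])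

lemma adjoint_familyD: "adjoint_family F \<Longrightarrow> e_diag a b * F k l =
    F k l * e_diag a b + ((if b = k then F a l else 0) - (if a = l then F k b else 0))"
  by (simp add: adjoint_family_def)

section \<open>Weight vectors\<close>

text \<open>The eigenvector condition for the adjoint action of the Cartan subalgebra, written as
  the rule by which Cartan elements are moved through \<open>x\<close>.\<close>

definition has_weight :: "'n::linorder abar \<Rightarrow> ('n \<Rightarrow> int) \<Rightarrow> bool" where
  "has_weight x \<mu> \<longleftrightarrow> (\<forall>a. h_diag a * x = x * h_diag a + scaleA (of_int (\<mu> a)) x)"

lemma has_weight_adjoint_family:
  assumes "adjoint_family F"
  shows "has_weight (F i j) (\<lambda>k. of_bool (k = i) - of_bool (k = j))"
  by (auto simp: has_weight_def h_diag_def adjoint_familyD[OF assms])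

lemma has_weight_mult:
  assumes "has_weight x \<mu>" "has_weight y \<nu>"
  shows "has_weight (x * y) (\<lambda>a. \<mu> a + \<nu> a)"
  unfolding has_weight_def
proof
  fix a
  have "h_diag a * (x * y) = x * (h_diag a * y) + scaleA (of_int (\<mu> a)) (x * y)"
    using assms(1) by (simp add: has_weight_def distrib_right flip: mult.assoc)
  also have "\<dots> = x * y * h_diag a + scaleA (of_int (\<mu> a + \<nu> a)) (x * y)"
    using assms(2) by (simp add: has_weight_def distrib_left mult.assoc abar.scale_left_distrib add_ac)
  finally show "h_diag a * (x * y) = x * y * h_diag a + scaleA (of_int (\<mu> a + \<nu> a)) (x * y)" .
qed

text \<open>Passing \<open>x\<close> shifts the root difference by \<open>\<mu> i - \<mu> j\<close>;
  cancelling the invertible root differences on both sides transfers the shift to the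
  inverses.\<close>

lemma has_weight_inv_root:
  assumes "has_weight x \<mu>" "i < j"
  shows "inv_root i j l * x = x * inv_root i j (l + \<mu> i - \<mu> j)"
proof -
  let ?l = "l + \<mu> i - \<mu> j"
  have h: "h_diag a * x = x * h_diag a + scaleA (of_int (\<mu> a)) x" for a
    using assms(1) by (simp add: has_weight_def)
  have "root_diffA i j l * x = x * root_diffA i j ?l"
    by (simp add: root_diffA_def distrib_left distrib_right left_diff_distrib right_diff_distrib h
        abar.scale_left_distrib abar.scale_left_diff_distrib)
  then have "inv_root i j l * x * (root_diffA i j ?l * inv_root i j ?l)
      = inv_root i j l * root_diffA i j l * x * inv_root i j ?l"
    by (simp add: mult.assoc)
  then show ?thesis
    by (simp add: root_diffA_inv[OF assms(2)])
qed

text \<open>Weight vectors normalize the Cartan coefficients. The existence of some new coefficient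
  is enough, since it is used for membership in spans and ideals and not for explicit
  formulas.\<close>

lemma has_weight_Uh_right:
  assumes "has_weight x \<mu>" "\<xi> \<in> Uh"
  shows "\<exists>\<xi>'\<in>Uh. \<xi> * x = x * \<xi>'"
  using assms(2)
proof induction
  case (h a)
  have "h_diag a * x = x * (h_diag a + scaleA (of_int (\<mu> a)) 1)"
    using assms(1) by (simp add: has_weight_def distrib_left)
  then show ?case
    by (metis Uh.intros)
next
  case (inv i j l)
  then show ?case
    using has_weight_inv_root[OF assms(1)] Uh.inv by blast
next
  case (add u v)
  then show ?case
    by (metis Uh.add distrib_left distrib_right)
next
  case (scale u c)
  then show ?case
    by (metis Uh.scale scaleA_mult_left scaleA_mult_right)
next
  case (mult u v)
  then show ?case
    by (metis Uh.mult mult.assoc)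
qed (use Uh.one in \<open>intro bexI[of _ 1], simp_all\<close>)

lemma has_weight_Uh_left:
  assumes "has_weight x \<mu>" "\<xi> \<in> Uh"
  shows "\<exists>\<xi>'\<in>Uh. x * \<xi> = \<xi>' * x"
  using assms(2)
proof induction
  case (h a)
  have "x * h_diag a = (h_diag a + scaleA (- of_int (\<mu> a)) 1) * x"
    using assms(1) by (simp add: has_weight_def left_diff_distrib)
  then show ?case
    by (metis Uh.intros)
next
  case (inv i j l)
  \<comment> \<open>The shift of \<open>l\<close> is opposite to the one above: moving this inverse
    to the right through \<open>x\<close> gives back \<open>inv_root i j l\<close>.\<close>
  then show ?case
    using has_weight_inv_root[OF assms(1) inv, of "l - \<mu> i + \<mu> j"] Uh.inv[OF inv]
    by (intro bexI[of _ "inv_root i j (l - \<mu> i + \<mu> j)"]) simp_all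
next
  case (add u v)
  then show ?case
    by (metis Uh.add distrib_left distrib_right)
next
  case (scale u c)
  then show ?case
    by (metis Uh.scale scaleA_mult_left scaleA_mult_right)
next
  case (mult u v)
  then show ?case
    by (metis Uh.mult mult.assoc)
qed (use Uh.one in \<open>intro bexI[of _ 1], simp_all\<close>)

section \<open>Root monomials and their weights\<close>

lemma lowering_Cons: "lowering ((i, j) # \<gamma>s) = e_diag j i * lowering \<gamma>s"
  by (simp add: lowering_def)

lemma raising_snoc: "raising (\<gamma>s @ [(i, j)]) = raising \<gamma>s * e_diag i j"
  by (simp add: raising_def)

lemma has_weight_lowering: "has_weight (lowering \<gamma>s) (\<lambda>k. - weight \<gamma>s k)"
proof (induction \<gamma>s)
  case Nil
  then show ?case
    by (simp add: has_weight_def lowering_def weight_def)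
next
  case (Cons \<gamma> \<gamma>s)
  obtain i j where "\<gamma> = (i, j)" by force
  then show ?case
    using has_weight_mult[OF has_weight_adjoint_family[OF adjoint_family_e_diag] Cons, of j i]
    by (simp add: lowering_Cons weight_def algebra_simps)
qed


lemma weight_Cons: "weight ((i, j) # \<gamma>s) k = of_bool (k = i) - of_bool (k = j) + weight \<gamma>s k"
  by (simp add: weight_def)

text \<open>Each positive root \<open>(i, j)\<close> here has \<open>m \<le> i < j\<close>, so
  \<open>m\<close> never occurs as a second index and there is no negative contribution.\<close>

lemma weight_at_minimum:
  assumes "set \<gamma>s \<subseteq> pos_roots" "\<forall>\<gamma>\<in>set \<gamma>s. m \<le> fst \<gamma>"
  shows "weight \<gamma>s m = int (length (filter (\<lambda>\<gamma>. fst \<gamma> = m) \<gamma>s))"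
  using assms
  by (induction \<gamma>s) (auto simp: weight_Cons pos_roots_def, simp add: weight_def)

text \<open>At the smallest first index the coordinate counts the roots starting there, and there is
  at least one.\<close>

lemma weight_ne_0:
  assumes "set \<gamma>s \<subseteq> pos_roots" "\<gamma>s \<noteq> []"
  shows "weight \<gamma>s \<noteq> weight []"
proof -
  define m where "m = Min (fst ` set \<gamma>s)"
  have "m \<in> fst ` set \<gamma>s"
    unfolding m_def using assms(2) by (intro Min_in) auto
  then have "filter (\<lambda>\<gamma>. fst \<gamma> = m) \<gamma>s \<noteq> []"
    by (auto simp: filter_empty_conv)
  moreover have "weight \<gamma>s m = int (length (filter (\<lambda>\<gamma>. fst \<gamma> = m) \<gamma>s))"
    using assms(1) by (rule weight_at_minimum) (simp add: m_def)
  ultimately have "weight \<gamma>s m \<noteq> weight [] m"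
    by (simp add: weight_def)
  then show ?thesis by metis
qed

text \<open>By zero weight, a term with a raising factor also has a lowering factor; it starts with the
  latter once the coefficient is moved to the right.\<close>

lemma zero_weight_term_factors:
  assumes "\<xi> \<in> Uh" "set \<gamma>s' \<subseteq> pos_roots" "weight \<gamma>s = weight \<gamma>s'" "\<gamma>s' \<noteq> []"
  shows "\<exists>(i, j)\<in>set \<gamma>s. \<exists>c. \<xi> * lowering \<gamma>s * raising \<gamma>s' = e_diag j i * c"
    and "\<exists>(i, j)\<in>set \<gamma>s'. \<exists>c. \<xi> * lowering \<gamma>s * raising \<gamma>s' = c * e_diag i j"
proof -
  have "\<gamma>s \<noteq> []"
    using weight_ne_0[OF assms(2,4)] assms(3) by auto
  then obtain i j \<delta>s where \<gamma>s: "\<gamma>s = (i, j) # \<delta>s"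
    by (cases \<gamma>s) auto
  obtain \<xi>' where "\<xi> * e_diag j i = e_diag j i * \<xi>'"
    using has_weight_Uh_right[OF has_weight_adjoint_family[OF adjoint_family_e_diag] assms(1)]
    by blast
  then have "\<xi> * lowering \<gamma>s * raising \<gamma>s' = e_diag j i * (\<xi>' * lowering \<delta>s * raising \<gamma>s')"
    by (metis \<gamma>s lowering_Cons mult.assoc)
  then show "\<exists>(i, j)\<in>set \<gamma>s. \<exists>c. \<xi> * lowering \<gamma>s * raising \<gamma>s' = e_diag j i * c"
    using \<gamma>s by auto
next
  obtain i j \<delta>s where "\<gamma>s' = \<delta>s @ [(i, j)]"
    using assms(4) by (metis rev_exhaust surj_pair)
  then show "\<exists>(i, j)\<in>set \<gamma>s'. \<exists>c. \<xi> * lowering \<gamma>s * raising \<gamma>s' = c * e_diag i j"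
    by (auto simp: raising_snoc simp flip: mult.assoc)
qed

section \<open>Powers of the left ideal generated by the raising operators\<close>

lemma e_diag_n_plus: "i < j \<Longrightarrow> e_diag i j \<in> n_plus"
  and e_diag_n_minus: "j < i \<Longrightarrow> e_diag i j \<in> n_minus"
  unfolding n_plus_def n_minus_def by (auto intro: abar.span_base)

lemma subspace_nplus_power_ideal: "abar.subspace (nplus_power_ideal N)"
  by (simp add: nplus_power_ideal_def)

lemma nplus_power_ideal_left: "x \<in> nplus_power_ideal N \<Longrightarrow> a * x \<in> nplus_power_ideal N"
  unfolding nplus_power_ideal_def
  by (erule span_mult_left, rule abar.span_base, unfold mem_Collect_eq) (metis mult.assoc)

lemma nplus_power_ideal_0: "x \<in> nplus_power_ideal 0"
  unfolding nplus_power_ideal_def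
  by (rule abar.span_base, rule CollectI, intro exI[of _ x] exI[of _ "[]"]) simp

lemma nplus_power_ideal_mult:
  fixes x :: "'a::linorder abar"
  assumes "x \<in> nplus_power_ideal N" "y \<in> n_plus"
  shows "x * y \<in> nplus_power_ideal (Suc N)"
  using assms(1) unfolding nplus_power_ideal_def
proof (rule span_mult_right)
  fix s :: "'a abar" assume "s \<in> {a * prod_list xs |a xs. set xs \<subseteq> n_plus \<and> length xs = N}"
  then obtain a xs where "s = a * prod_list xs" "set xs \<subseteq> n_plus" "length xs = N" by blast
  with assms(2) have "s * y = a * prod_list (xs @ [y])" "set (xs @ [y]) \<subseteq> n_plus"
      "length (xs @ [y]) = Suc N"
    by (simp_all add: mult.assoc)
  then show "s * y \<in> abar.span {a * prod_list xs |a xs. set xs \<subseteq> n_plus \<and> length xs = Suc N}"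
    by (intro abar.span_base) blast
qed

text \<open>The last factor is split off and expanded in root vectors. Inductions on
  \<open>N\<close> use this form because an element multiplied from the right meets the last factor
  first.\<close>

lemma nplus_power_ideal_Suc:
  fixes x :: "'a::linorder abar"
  assumes "x \<in> nplus_power_ideal (Suc N)"
  shows "x \<in> abar.span {u * e_diag i j |u i j. u \<in> nplus_power_ideal N \<and> i < j}"
    (is "_ \<in> abar.span ?T")
proof -
  have "s \<in> abar.span ?T" if s: "s = a * prod_list xs" "set xs \<subseteq> n_plus" "length xs = Suc N"
    for s a :: "'a abar" and xs
  proof -
    obtain ys y where xs: "xs = ys @ [y]"
      using s(3) by (metis length_Suc_conv rev_exhaust neq_Nil_conv)
    have "a * prod_list ys \<in> nplus_power_ideal N"
      unfolding nplus_power_ideal_def using s xs by (intro abar.span_base) auto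
    moreover have "y \<in> abar.span {e_diag i j |i j. i < j}"
      using s(2) xs by (simp add: n_plus_def)
    ultimately have "a * prod_list ys * y \<in> abar.span ?T"
      by (elim span_mult_left) (auto intro!: abar.span_base)
    then show ?thesis
      by (simp add: s(1) xs mult.assoc)
  qed
  then have "{a * prod_list xs |a xs. set xs \<subseteq> n_plus \<and> length xs = Suc N} \<subseteq> abar.span ?T"
    by blast
  from abar.span_minimal[OF this] assms show ?thesis
    by (auto simp: nplus_power_ideal_def)
qed

text \<open>The first of the \<open>Suc N\<close> factors is absorbed into the left
  coefficient.\<close>

lemma nplus_power_ideal_Suc_subset:
  "nplus_power_ideal (Suc N) \<subseteq> (nplus_power_ideal N :: 'a::linorder abar set)"
  unfolding nplus_power_ideal_def
proof (rule abar.span_mono, safe)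
  fix a :: "'a abar" and xs :: "'a abar list" assume "set xs \<subseteq> n_plus" "length xs = Suc N"
  then obtain y ys where xs: "xs = y # ys" "set ys \<subseteq> n_plus" "length ys = N"
    by (cases xs) auto
  then have "a * prod_list xs = (a * y) * prod_list ys"
    by (simp add: mult.assoc)
  with xs show "\<exists>b ys. a * prod_list xs = b * prod_list ys \<and> set ys \<subseteq> n_plus \<and> length ys = N"
    by blast
qed

lemma nplus_power_ideal_antimono:
  "M \<le> N \<Longrightarrow> x \<in> nplus_power_ideal N \<Longrightarrow> x \<in> nplus_power_ideal M"
  using lift_Suc_antimono_le[of nplus_power_ideal M N] nplus_power_ideal_Suc_subset by blast

text \<open>For exponent 1 this is the left ideal generated by \<open>n_plus\<close>, one of the two
  halves of \<open>coset_space\<close>. It is the passage from convergence of series to equality of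
  classes.\<close>

lemma nplus_power_ideal_1: "x \<in> nplus_power_ideal 1 \<Longrightarrow> x \<in> coset_space"
  using nplus_power_ideal_Suc[of x 0] unfolding coset_space_def One_nat_def
  by (rule set_mp[OF abar.span_mono, rotated]) (auto intro: e_diag_n_plus)

text \<open>Root vectors are weight vectors, so the coefficient moves left past all \<open>N\<close>
  factors and none of them is lost.\<close>

lemma nplus_power_ideal_Uh:
  "x \<in> nplus_power_ideal N \<Longrightarrow> \<xi> \<in> Uh \<Longrightarrow> x * \<xi> \<in> nplus_power_ideal N"
proof (induction N arbitrary: x \<xi>)
  case (Suc N)
  have gen: "s * \<xi> \<in> abar.span (nplus_power_ideal (Suc N))"
    if s: "s = u * e_diag i j" "u \<in> nplus_power_ideal N" "i < j" for s u i j
  proof -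
    obtain \<xi>' where \<xi>': "\<xi>' \<in> Uh" "e_diag i j * \<xi> = \<xi>' * e_diag i j"
      using has_weight_Uh_left[OF has_weight_adjoint_family[OF adjoint_family_e_diag] Suc.prems(2)]
      by blast
    have "(u * \<xi>') * e_diag i j \<in> nplus_power_ideal (Suc N)"
      using Suc.IH[OF s(2) \<xi>'(1)] e_diag_n_plus[OF s(3)] by (rule nplus_power_ideal_mult)
    then show ?thesis
      by (intro abar.span_base) (simp add: s(1) mult.assoc \<xi>'(2))
  qed
  have "x * \<xi> \<in> abar.span (nplus_power_ideal (Suc N))"
    by (rule span_mult_right[OF nplus_power_ideal_Suc[OF Suc.prems(1)]]) (use gen in blast)
  then show ?case
    using subspace_nplus_power_ideal abar.span_eq_iff by blast
qed (rule nplus_power_ideal_0)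

text \<open>Commuting \<open>e\<^sub>a\<^sub>b\<close> with \<open>a < b\<close> past \<open>F i j\<close> lowers \<open>i\<close> or raises \<open>j\<close>, which can happen
  only boundedly often.\<close>

lemma nplus_power_ideal_adjoint_family:
  fixes F :: "'n::{finite,linorder} \<Rightarrow> 'n \<Rightarrow> 'n abar"
  assumes "adjoint_family F"
  shows "card {..<i} + card {j<..} < h \<Longrightarrow> x \<in> nplus_power_ideal (k + h) \<Longrightarrow>
    x * F i j \<in> nplus_power_ideal k"
proof (induction h arbitrary: i j k x)
  case (Suc h)
  note outer = Suc.IH and small = Suc.prems(1)
  \<comment> \<open>The outer induction on \<open>h\<close> bounds the possible index changes of
    \<open>F\<close>; the inner one on \<open>k\<close> moves a root vector through an unchanged
    \<open>F i j\<close>.\<close>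
  show ?case
    using Suc.prems(2)
  proof (induction k arbitrary: x)
    case (Suc k)
    have gen: "s * F i j \<in> abar.span (nplus_power_ideal (Suc k))"
      if s: "s = u * e_diag a b" "u \<in> nplus_power_ideal (k + Suc h)" "a < b" for s u a b
    proof -
      \<comment> \<open>One factor is exchanged between the counters: a commutator term involves
        fewer remaining index changes, so \<open>h\<close> suffices for it and the spare factor
        raises \<open>k\<close>.\<close>
      have u: "u \<in> nplus_power_ideal (Suc k + h)"
        using s(2) by simp
      have 1: "u * F i j * e_diag a b \<in> nplus_power_ideal (Suc k)"
        using Suc.IH[OF s(2)] e_diag_n_plus[OF s(3)] by (rule nplus_power_ideal_mult)
      have 2: "u * F a j \<in> nplus_power_ideal (Suc k)" if "b = i"
      proof (rule outer[OF _ u])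
        have "card {..<a} < card {..<i}"
          using s(3) that by (intro psubset_card_mono) auto
        with small show "card {..<a} + card {j<..} < h" by simp
      qed
      have 3: "u * F i b \<in> nplus_power_ideal (Suc k)" if "a = j"
      proof (rule outer[OF _ u])
        have "card {b<..} < card {j<..}"
          using s(3) that by (intro psubset_card_mono) auto
        with small show "card {..<i} + card {b<..} < h" by simp
      qed
      have "s * F i j = u * F i j * e_diag a b +
          ((if b = i then u * F a j else 0) - (if a = j then u * F i b else 0))"
        by (simp add: s(1) mult.assoc adjoint_familyD[OF assms] distrib_left right_diff_distrib)
      also have "\<dots> \<in> nplus_power_ideal (Suc k)"
        using 1 2 3 by (auto intro!: abar.subspace_add[OF subspace_nplus_power_ideal]
            abar.subspace_diff[OF subspace_nplus_power_ideal]
            abar.subspace_0[OF subspace_nplus_power_ideal])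
      finally show ?thesis
        by (rule abar.span_base)
    qed
    have "x \<in> nplus_power_ideal (Suc (k + Suc h))"
      using Suc.prems by simp
    from nplus_power_ideal_Suc[OF this]
    have "x * F i j \<in> abar.span (nplus_power_ideal (Suc k))"
      by (rule span_mult_right) (use gen in blast)
    then show ?case
      using subspace_nplus_power_ideal abar.span_eq_iff by blast
  qed (rule nplus_power_ideal_0)
qed simp

text \<open>Right multiplication by a fixed element is continuous for the topology given by the
  power ideals, because it is so for generators and the property passes to sums, multiples and
  products.\<close>

lemma nplus_power_ideal_right:
  fixes b :: "'n::{finite,linorder} abar"
  shows "\<exists>N. \<forall>x\<in>nplus_power_ideal N. x * b \<in> nplus_power_ideal k"
proof (induction b arbitrary: k rule: abar_induct)
  case (E1 i j)
  then show ?case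
    using nplus_power_ideal_adjoint_family[OF adjoint_family_E1 lessI] by blast
next
  case (E2 i j)
  then show ?case
    using nplus_power_ideal_adjoint_family[OF adjoint_family_E2 lessI] by blast
next
  case (inv i j l)
  then show ?case
    using nplus_power_ideal_Uh Uh.inv by blast
next
  case one
  then show ?case by auto
next
  case (add x y)
  then obtain M N where "\<forall>z\<in>nplus_power_ideal M. z * x \<in> nplus_power_ideal k"
      "\<forall>z\<in>nplus_power_ideal N. z * y \<in> nplus_power_ideal k"
    by meson
  then have "\<forall>z\<in>nplus_power_ideal (max M N). z * (x + y) \<in> nplus_power_ideal k"
    using nplus_power_ideal_antimono[of M "max M N"] nplus_power_ideal_antimono[of N "max M N"]
    by (auto simp: distrib_left intro!: abar.subspace_add[OF subspace_nplus_power_ideal])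
  then show ?case by blast
next
  case (scale c x)
  then obtain N where "\<forall>z\<in>nplus_power_ideal N. z * x \<in> nplus_power_ideal k"
    by blast
  then have "\<forall>z\<in>nplus_power_ideal N. z * scaleA c x \<in> nplus_power_ideal k"
    by (simp add: abar.subspace_scale[OF subspace_nplus_power_ideal])
  then show ?case by blast
next
  case (mult x y)
  \<comment> \<open>The factor \<open>y\<close> comes first: its bound \<open>M\<close> is the
    exponent that multiplication by \<open>x\<close> has to leave over.\<close>
  obtain M where "\<forall>z\<in>nplus_power_ideal M. z * y \<in> nplus_power_ideal k"
    using mult(2) by blast
  moreover obtain N where "\<forall>z\<in>nplus_power_ideal N. z * x \<in> nplus_power_ideal M"
    using mult(1) by blast
  ultimately have "\<forall>z\<in>nplus_power_ideal N. z * (x * y) \<in> nplus_power_ideal k"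
    by (simp flip: mult.assoc)
  then show ?case by blast
qed

text \<open>By continuity a null sequence stays null between two fixed factors; exponent 1 already
  makes the class vanish.\<close>

lemma tends_to_zero_mult:
  fixes s :: "nat \<Rightarrow> 'n::{finite,linorder} abar"
  assumes "tends_to_zero s"
  shows "\<forall>\<^sub>F M in sequentially. a * s M * b \<in> nplus_power_ideal 1"
proof -
  obtain N where N: "\<forall>x\<in>nplus_power_ideal N. x * b \<in> nplus_power_ideal 1"
    using nplus_power_ideal_right by blast
  have "\<forall>\<^sub>F M in sequentially. s M \<in> nplus_power_ideal N"
    using assms by (simp add: tends_to_zero_def)
  then show ?thesis
    by (rule eventually_mono) (use N in \<open>simp only: nplus_power_ideal_left mult.assoc\<close>)
qed

section \<open>The product of the double coset space\<close>

lemma to_dra_eq_iff: "to_dra x = to_dra y \<longleftrightarrow> x - y \<in> coset_space"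
  unfolding to_dra_def by (rule dra.abs_eq_iff)

lemma to_dra_add: "to_dra (x + y) = to_dra x + to_dra y"
  and to_dra_diff: "to_dra (x - y) = to_dra x - to_dra y"
  and to_dra_zero: "to_dra 0 = 0"
  and to_dra_scale: "to_dra (scaleA c x) = scaleZ c (to_dra x)"
  by (simp_all add: to_dra_def plus_dra.abs_eq minus_dra.abs_eq zero_dra.abs_eq scaleZ.abs_eq)

lemma to_dra_eq_0_iff: "to_dra x = 0 \<longleftrightarrow> x \<in> coset_space"
  using to_dra_eq_iff[of x 0] by (simp add: to_dra_zero)

lemma to_dra_cases: obtains a where "x = to_dra a"
  using dra.abs_induct[of "\<lambda>x. \<exists>a. x = to_dra a" x] to_dra_def by metis

lemma iota_to_dra: "iota (to_dra a) = to_dra (emb a)"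
  by (simp add: to_dra_def iota.abs_eq)

lemma coset_space_left: "y \<in> n_minus \<Longrightarrow> y * a \<in> coset_space"
  and coset_space_right: "x \<in> n_plus \<Longrightarrow> a * x \<in> coset_space"
  unfolding coset_space_def by (auto intro!: abar.span_base)

lemma subspace_coset_space: "abar.subspace coset_space"
  by (simp add: coset_space_def)

section \<open>Truncated series and well-definedness of the product\<close>

lemma formal_series_nplus_power_ideal:
  assumes "formal_series P"
  shows "P d \<in> nplus_power_ideal d"
proof -
  have "zero_weight_terms d \<subseteq> (nplus_power_ideal d :: 'a abar set)"
  proof
    fix t :: "'a abar" assume "t \<in> zero_weight_terms d"
    then obtain \<xi> \<gamma>s \<gamma>s' where t: "t = \<xi> * lowering \<gamma>s * raising \<gamma>s'"
        "set \<gamma>s' \<subseteq> pos_roots" "length \<gamma>s' = d"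
      by (auto simp: zero_weight_terms_def)
    then have "set (map (\<lambda>(i, j). e_diag i j) \<gamma>s') \<subseteq> (n_plus :: 'a abar set)"
      by (auto simp: pos_roots_def intro: e_diag_n_plus)
    with t show "t \<in> nplus_power_ideal d"
      unfolding nplus_power_ideal_def raising_def by (intro abar.span_base) force
  qed
  from abar.span_minimal[OF this subspace_nplus_power_ideal] assms show ?thesis
    by (auto simp: formal_series_def)
qed

lemma psum_Suc: "psum P (Suc M) = psum P M + P M"
  by (simp add: psum_def)

text \<open>Since \<open>P d\<close> lies in the power ideal of exponent \<open>d\<close>, a late
  term multiplied by \<open>b\<close> still ends in the left ideal generated by
  \<open>n_plus\<close> and does not change the class.\<close>

lemma eventually_to_dra_const:
  fixes P :: "nat \<Rightarrow> 'n::{finite,linorder} abar"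
  assumes "formal_series P"
  shows "\<exists>w. \<forall>\<^sub>F M in sequentially. to_dra (a * psum P M * b) = w"
proof -
  obtain N where N: "\<forall>x\<in>nplus_power_ideal N. x * b \<in> nplus_power_ideal 1"
    using nplus_power_ideal_right by blast
  have "to_dra (a * psum P M * b) = to_dra (a * psum P N * b)" if "N \<le> M" for M
    using that
  proof (induction M rule: dec_induct)
    case (step M)
    have "P M \<in> nplus_power_ideal N"
      using step.hyps(1) formal_series_nplus_power_ideal[OF assms] nplus_power_ideal_antimono by blast
    then have "a * P M * b \<in> coset_space"
      using N by (simp add: mult.assoc nplus_power_ideal_1 nplus_power_ideal_left)
    with step.IH show ?case
      by (simp add: psum_Suc distrib_left distrib_right to_dra_add to_dra_eq_0_iff)
  qed simp
  then show ?thesis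
    unfolding eventually_sequentially by blast
qed

text \<open>A raising factor at the right end of \<open>a\<close> meets the projector and is removed
  by \<open>n_+ P = 0\<close>; a lowering factor at the left end of \<open>a\<close> stays leftmost
  for every truncation.\<close>

lemma eventually_coset_left:
  fixes P :: "nat \<Rightarrow> 'n::{finite,linorder} abar"
  assumes "extremal_projector P" "a \<in> coset_space"
  shows "\<forall>\<^sub>F M in sequentially. a * psum P M * b \<in> coset_space"
  using assms(2) unfolding coset_space_def
proof (induction rule: abar.span_induct_alt)
  case base
  then show ?case
    by (simp add: abar.span_zero)
next
  case (step c x y)
  have "\<forall>\<^sub>F M in sequentially. x * psum P M * b \<in> coset_space"
    using step(1)
  proof (elim UnE CollectE exE conjE)
    fix u v assume "x = u * v" "v \<in> n_plus"
    with assms(1) have "tends_to_zero (\<lambda>M. v * psum P M)"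
      by (simp add: extremal_projector_def)
    from tends_to_zero_mult[OF this, of u b] show ?thesis
      by eventually_elim (simp add: \<open>x = u * v\<close> mult.assoc nplus_power_ideal_1)
  next
    fix u v assume "x = u * v" "u \<in> n_minus"
    then show ?thesis
      by (simp add: mult.assoc coset_space_left)
  qed
  with step(2) show ?case
    unfolding coset_space_def
    by eventually_elim (simp add: distrib_right abar.span_add abar.span_scale)
qed

text \<open>Here the raising factor stays rightmost, and the lowering factor at the left end of
  \<open>b\<close> is removed by \<open>P n_- = 0\<close>.\<close>

lemma eventually_coset_right:
  fixes P :: "nat \<Rightarrow> 'n::{finite,linorder} abar"
  assumes "extremal_projector P" "b \<in> coset_space"
  shows "\<forall>\<^sub>F M in sequentially. a * psum P M * b \<in> coset_space"
  using assms(2) unfolding coset_space_def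
proof (induction rule: abar.span_induct_alt)
  case base
  then show ?case
    by (simp add: abar.span_zero)
next
  case (step c x y)
  have "\<forall>\<^sub>F M in sequentially. a * psum P M * x \<in> coset_space"
    using step(1)
  proof (elim UnE CollectE exE conjE)
    fix u v assume "x = u * v" "v \<in> n_plus"
    then show ?thesis
      by (simp add: coset_space_right flip: mult.assoc)
  next
    fix u v assume "x = v * u" "v \<in> n_minus"
    with assms(1) have "tends_to_zero (\<lambda>M. psum P M * v)"
      by (simp add: extremal_projector_def)
    from tends_to_zero_mult[OF this, of a u] show ?thesis
      by eventually_elim (simp add: \<open>x = v * u\<close> mult.assoc nplus_power_ideal_1)
  qed
  with step(2) show ?case
    unfolding coset_space_def
    by eventually_elim (simp add: distrib_left abar.span_add abar.span_scale)
qed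

text \<open>This justifies the definite description in \<open>diamond\<close>. A change of
  representatives alters the truncated product by \<open>(a' - a) P b' + a P (b' - b)\<close>, and
  both summands eventually have class zero.\<close>

lemma diamond_to_dra:
  fixes P :: "nat \<Rightarrow> 'n::{finite,linorder} abar"
  assumes "extremal_projector P"
  shows "\<forall>\<^sub>F M in sequentially. to_dra (a * psum P M * b) = diamond P (to_dra a) (to_dra b)"
proof -
  obtain w where w: "\<forall>\<^sub>F M in sequentially. to_dra (a * psum P M * b) = w"
    using eventually_to_dra_const assms unfolding extremal_projector_def by blast
  have "\<forall>\<^sub>F M in sequentially. to_dra (a' * psum P M * b') = w"
    if "to_dra a' = to_dra a" "to_dra b' = to_dra b" for a' b'
  proof -
    have "\<forall>\<^sub>F M in sequentially. (a' - a) * psum P M * b' \<in> coset_space"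
      using that(1) by (intro eventually_coset_left[OF assms]) (simp add: to_dra_eq_iff)
    moreover have "\<forall>\<^sub>F M in sequentially. a * psum P M * (b' - b) \<in> coset_space"
      using that(2) by (intro eventually_coset_right[OF assms]) (simp add: to_dra_eq_iff)
    ultimately show ?thesis
      using w
    proof eventually_elim
      case (elim M)
      then show ?case
        by (simp add: left_diff_distrib right_diff_distrib to_dra_diff flip: to_dra_eq_0_iff)
    qed
  qed
  then have "diamond P (to_dra a) (to_dra b) = w"
    unfolding diamond_def
  proof (intro the_equality allI impI)
    fix w' assume "\<forall>a' b'. to_dra a' = to_dra a \<longrightarrow> to_dra b' = to_dra b \<longrightarrow>
        (\<forall>\<^sub>F M in sequentially. to_dra (a' * psum P M * b') = w')"
    then have "\<forall>\<^sub>F M in sequentially. to_dra (a * psum P M * b) = w'" by blast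
    \<comment> \<open>Both eventual values are attained at a common large \<open>M\<close>, so they
      coincide.\<close>
    with w have "\<forall>\<^sub>F M :: nat in sequentially. w' = w"
      by eventually_elim simp
    then show "w' = w" by simp
  qed blast
  with w show ?thesis by simp
qed


section \<open>The non-constant terms of the projector\<close>

lemma psum_minus_one:
  assumes "extremal_projector P" "0 < M" "\<And>d. 0 < d \<Longrightarrow> zero_weight_terms d \<subseteq> S"
  shows "psum P M - 1 \<in> abar.span S"
proof -
  have "P d \<in> abar.span S" if "0 < d" for d
    using assms(1) abar.span_mono[OF assms(3)[OF that]]
    by (auto simp: extremal_projector_def formal_series_def)
  then have "(\<Sum>d\<in>{..<M} - {0}. P d) \<in> abar.span S"
    by (intro abar.span_sum) auto
  \<comment> \<open>The condition \<open>0 < M\<close> puts the constant term \<open>P 0 = 1\<close>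
    into the truncation, where it cancels the subtracted 1.\<close>
  moreover have "psum P M = P 0 + (\<Sum>d\<in>{..<M} - {0}. P d)"
    unfolding psum_def using assms(2) by (intro sum.remove) auto
  ultimately show ?thesis
    using assms(1) by (simp add: extremal_projector_def)
qed

text \<open>In the comparison of the products the leading lowering factor is annihilated by a
  projector on its left; the trailing raising factor of \<open>zero_weight_terms_end\<close> is
  annihilated by one on its right.\<close>

lemma zero_weight_terms_start:
  assumes "0 < d"
  shows "zero_weight_terms d \<subseteq> {e_diag j i * c |i j c. i < j}"
proof
  fix t :: "'a abar" assume "t \<in> zero_weight_terms d"
  then obtain \<xi> \<gamma>s \<gamma>s' where t: "t = \<xi> * lowering \<gamma>s * raising \<gamma>s'" "\<xi> \<in> Uh"
      "set \<gamma>s \<subseteq> pos_roots" "set \<gamma>s' \<subseteq> pos_roots" "weight \<gamma>s = weight \<gamma>s'" "length \<gamma>s' = d"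
    by (auto simp: zero_weight_terms_def)
  then have "\<gamma>s' \<noteq> []"
    using assms by auto
  from zero_weight_term_factors(1)[OF t(2,4,5) this]
  obtain i j c where "(i, j) \<in> set \<gamma>s" "t = e_diag j i * c"
    unfolding t(1) by blast
  with t(3,4) show "t \<in> {e_diag j i * c |i j c. i < j}"
    unfolding pos_roots_def by blast
qed

lemma zero_weight_terms_end:
  assumes "0 < d"
  shows "zero_weight_terms d \<subseteq> {c * e_diag i j |i j c. i < j}"
proof
  fix t :: "'a abar" assume "t \<in> zero_weight_terms d"
  then obtain \<xi> \<gamma>s \<gamma>s' where t: "t = \<xi> * lowering \<gamma>s * raising \<gamma>s'" "\<xi> \<in> Uh"
      "set \<gamma>s \<subseteq> pos_roots" "set \<gamma>s' \<subseteq> pos_roots" "weight \<gamma>s = weight \<gamma>s'" "length \<gamma>s' = d"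
    by (auto simp: zero_weight_terms_def)
  then have "\<gamma>s' \<noteq> []"
    using assms by auto
  from zero_weight_term_factors(2)[OF t(2,4,5) this]
  obtain i j c where "(i, j) \<in> set \<gamma>s'" "t = c * e_diag i j"
    unfolding t(1) by blast
  with t(3,4) show "t \<in> {c * e_diag i j |i j c. i < j}"
    unfolding pos_roots_def by blast
qed

section \<open>The new root vectors\<close>

lemma emb_one [simp]: "emb 1 = 1"
  by transfer (simp add: two_sided_ideal.zero)

lemma emb_E1: "emb (E1 i j) = E1 (Old i) (Old j)"
  and emb_E2: "emb (E2 i j) = E2 (Old i) (Old j)"
  and emb_inv_root: "emb (inv_root i j l) = inv_root (Old i) (Old j) l"
  by (transfer; simp add: two_sided_ideal.zero)+

lemma emb_prod_list: "emb (prod_list xs) = prod_list (map emb xs)"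
  by (induction xs) (simp_all add: emb_mult)

lemma emb_nplus_power_ideal: "x \<in> nplus_power_ideal N \<Longrightarrow> emb x \<in> nplus_power_ideal N"
  unfolding nplus_power_ideal_def
proof (erule emb_span, rule abar.span_base, elim CollectE exE conjE)
  fix s a :: "'a abar" and xs assume "s = a * prod_list xs" "set xs \<subseteq> n_plus" "length xs = N"
  then have "emb s = emb a * prod_list (map emb xs)" "set (map emb xs) \<subseteq> n_plus"
      "length (map emb xs) = N"
    by (auto simp: emb_mult emb_prod_list emb_n_plus)
  then show "emb s \<in> {a * prod_list xs |a xs. set xs \<subseteq> n_plus \<and> length xs = N}"
    by blast
qed

lemma emb_tends_to_zero: "tends_to_zero s \<Longrightarrow> tends_to_zero (\<lambda>M. emb (s M))"
  unfolding tends_to_zero_def by (meson emb_nplus_power_ideal eventually_mono)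

lemma Old_less_Last [simp]: "Old i < Last" and not_Last_less [simp]: "\<not> Last < j"
  by (simp_all add: less_plus1_def)

lemma less_Last_iff: "i < Last \<longleftrightarrow> (\<exists>k. i = Old k)"
  by (cases i) auto

lemma less_Old_iff: "i < Old j \<longleftrightarrow> (\<exists>k. i = Old k \<and> k < j)"
  by (cases i) auto

text \<open>This is the ideal \<open>L\<close>. Generators from both copies are included, so that it
  contains \<open>e_diag (Old k) Last\<close> as well as \<open>E_diff (Old k) Last\<close>;
  \<open>last_right\<close> is the mirror right ideal.\<close>

definition last_left :: "'n::linorder plus1 abar set" where
  "last_left = abar.span {a * F (Old k) Last |a F k. F \<in> {E1, E2}}"

definition last_right :: "'n::linorder plus1 abar set" where
  "last_right = abar.span {F Last (Old k) * a |a F k. F \<in> {E1, E2}}"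

lemma subspace_last_left: "abar.subspace last_left"
  and subspace_last_right: "abar.subspace last_right"
  by (simp_all add: last_left_def last_right_def)

lemma last_left_base: "F \<in> {E1, E2} \<Longrightarrow> a * F (Old k) Last \<in> last_left"
  and last_right_base: "F \<in> {E1, E2} \<Longrightarrow> F Last (Old k) * a \<in> last_right"
  unfolding last_left_def last_right_def by (auto intro!: abar.span_base)

lemma last_left_left: "x \<in> last_left \<Longrightarrow> a * x \<in> last_left"
  unfolding last_left_def
  by (erule span_mult_left, rule abar.span_base, unfold mem_Collect_eq) (metis mult.assoc)

lemma last_right_right: "x \<in> last_right \<Longrightarrow> x * a \<in> last_right"
  unfolding last_right_def
  by (erule span_mult_right, rule abar.span_base, unfold mem_Collect_eq) (metis mult.assoc)

lemma last_left_e_diag: "e_diag (Old k) Last \<in> last_left"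
  using last_left_base[of E1 1 k] last_left_base[of E2 1 k]
  by (simp add: e_diag_def abar.subspace_add[OF subspace_last_left])

lemma last_right_e_diag: "e_diag Last (Old k) \<in> last_right"
  using last_right_base[of E1 k 1] last_right_base[of E2 k 1]
  by (simp add: e_diag_def abar.subspace_add[OF subspace_last_right])

text \<open>The commutator with a matrix unit of the small algebra is zero or, for
  \<open>j = k\<close> in the same copy, a multiple of \<open>F (Old i) Last\<close>. Inverses pass
  the weight vector at the cost of a shift.\<close>

lemma last_left_emb_generators:
  assumes "F \<in> {E1, E2}"
  shows "F (Old k) Last * E1 (Old i) (Old j) \<in> last_left"
    and "F (Old k) Last * E2 (Old i) (Old j) \<in> last_left"
    and "i < j \<Longrightarrow> F (Old k) Last * inv_root (Old i) (Old j) l \<in> last_left"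
proof -
  have "F (Old k) Last * E1 (Old i) (Old j) \<in> last_left \<and> F (Old k) Last * E2 (Old i) (Old j) \<in> last_left"
    using assms last_left_base[of E1 _ k] last_left_base[of E2 _ k]
      last_left_base[of E1 1 i] last_left_base[of E2 1 i]
    by (auto simp: E1_E1[of "Old k" Last] E2_E2[of "Old k" Last] E1_E2[of "Old k" Last]
        E1_E2[of _ _ "Old k" Last, symmetric] abar.subspace_diff[OF subspace_last_left])
  then show "F (Old k) Last * E1 (Old i) (Old j) \<in> last_left"
      "F (Old k) Last * E2 (Old i) (Old j) \<in> last_left"
    by auto
  assume "i < j"
  have "adjoint_family F"
    using assms adjoint_family_E1 adjoint_family_E2 by auto
  then obtain \<xi> where "F (Old k) Last * inv_root (Old i) (Old j) l = \<xi> * F (Old k) Last"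
    using has_weight_Uh_left[OF has_weight_adjoint_family Uh.inv[of "Old i" "Old j"]] \<open>i < j\<close>
    by fastforce
  then show "F (Old k) Last * inv_root (Old i) (Old j) l \<in> last_left"
    using last_left_base[OF assms] by simp
qed

text \<open>The mirror computation: the only possible commutator term is a multiple of
  \<open>F Last (Old j)\<close>, occurring for \<open>i = k\<close> in the same copy.\<close>

lemma last_right_emb_generators:
  assumes "F \<in> {E1, E2}"
  shows "E1 (Old i) (Old j) * F Last (Old k) \<in> last_right"
    and "E2 (Old i) (Old j) * F Last (Old k) \<in> last_right"
    and "i < j \<Longrightarrow> inv_root (Old i) (Old j) l * F Last (Old k) \<in> last_right"
proof -
  have "E1 (Old i) (Old j) * F Last (Old k) \<in> last_right \<and> E2 (Old i) (Old j) * F Last (Old k) \<in> last_right"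
    using assms last_right_base[of E1 k] last_right_base[of E2 k]
      last_right_base[of E1 j 1] last_right_base[of E2 j 1]
    by (auto simp: E1_E1[of _ _ Last "Old k"] E2_E2[of _ _ Last "Old k"] E1_E2[of _ _ Last "Old k"]
        E1_E2[of Last "Old k", symmetric] abar.subspace_diff[OF subspace_last_right])
  then show "E1 (Old i) (Old j) * F Last (Old k) \<in> last_right"
      "E2 (Old i) (Old j) * F Last (Old k) \<in> last_right"
    by auto
  assume "i < j"
  have "adjoint_family F"
    using assms adjoint_family_E1 adjoint_family_E2 by auto
  then obtain \<xi> where "inv_root (Old i) (Old j) l * F Last (Old k) = F Last (Old k) * \<xi>"
    using has_weight_Uh_right[OF has_weight_adjoint_family Uh.inv[of "Old i" "Old j"]] \<open>i < j\<close>
    by fastforce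
  then show "inv_root (Old i) (Old j) l * F Last (Old k) \<in> last_right"
    using last_right_base[OF assms] by simp
qed

text \<open>Left coefficients are harmless in a left ideal, so stability under right multiplication
  by \<open>b\<close> is decided on the generators.\<close>

lemma last_left_generator:
  assumes "x \<in> last_left" "\<And>F k. F \<in> {E1, E2} \<Longrightarrow> F (Old k) Last * b \<in> last_left"
  shows "x * b \<in> last_left"
proof -
  \<comment> \<open>The unit factor matches the two-sided form of
    \<open>subspace_vimage_mult\<close>.\<close>
  have "1 * x * b \<in> last_left"
    using assms(1)[unfolded last_left_def]
  proof (rule span_subspace_induct[OF _ subspace_vimage_mult])
    fix s :: "'a plus1 abar" assume "s \<in> {a * F (Old k) Last |a F k. F \<in> {E1, E2}}"
    then obtain a F k where s: "s = a * F (Old k) Last" "F \<in> {E1, E2}" by blast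
    show "1 * s * b \<in> last_left"
      using last_left_left[OF assms(2)[OF s(2)]] by (simp add: s(1) mult.assoc)
  qed (simp add: subspace_last_left)
  then show ?thesis by simp
qed

lemma last_right_generator:
  assumes "x \<in> last_right" "\<And>F k. F \<in> {E1, E2} \<Longrightarrow> b * F Last (Old k) \<in> last_right"
  shows "b * x \<in> last_right"
proof -
  have "b * x * 1 \<in> last_right"
    using assms(1)[unfolded last_right_def]
  proof (rule span_subspace_induct[OF _ subspace_vimage_mult])
    fix s :: "'a plus1 abar" assume "s \<in> {F Last (Old k) * a |a F k. F \<in> {E1, E2}}"
    then obtain a F k where s: "s = F Last (Old k) * a" "F \<in> {E1, E2}" by blast
    show "b * s * 1 \<in> last_right"
      using last_right_right[OF assms(2)[OF s(2)]] by (simp add: s(1) mult.assoc)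
  qed (simp add: subspace_last_right)
  then show ?thesis by simp
qed

text \<open>Although \<open>L\<close> is a left ideal, it absorbs factors of the small algebra on
  the right; sums, multiples and products reduce this to generators.\<close>

lemma last_left_emb: "x \<in> last_left \<Longrightarrow> x * emb b \<in> last_left"
proof (induction b arbitrary: x rule: abar_induct)
  case (E1 i j)
  then show ?case
    unfolding emb_E1 using last_left_emb_generators(1) by (rule last_left_generator)
next
  case (E2 i j)
  then show ?case
    unfolding emb_E2 using last_left_emb_generators(2) by (rule last_left_generator)
next
  case (inv i j l)
  show ?case
    unfolding emb_inv_root using inv(2) last_left_emb_generators(3)[OF _ inv(1)]
    by (rule last_left_generator)
qed (simp_all add: emb_mult emb_add emb_scale distrib_left abar.subspace_add[OF subspace_last_left]
    abar.subspace_scale[OF subspace_last_left] flip: mult.assoc)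

lemma last_right_emb: "x \<in> last_right \<Longrightarrow> emb b * x \<in> last_right"
proof (induction b arbitrary: x rule: abar_induct)
  case (E1 i j)
  then show ?case
    unfolding emb_E1 using last_right_emb_generators(1) by (rule last_right_generator)
next
  case (E2 i j)
  then show ?case
    unfolding emb_E2 using last_right_emb_generators(2) by (rule last_right_generator)
next
  case (inv i j l)
  show ?case
    unfolding emb_inv_root using inv(2) last_right_emb_generators(3)[OF _ inv(1)]
    by (rule last_right_generator)
qed (simp_all add: emb_mult emb_add emb_scale distrib_right abar.subspace_add[OF subspace_last_right]
    abar.subspace_scale[OF subspace_last_right] mult.assoc)

text \<open>Reading from the right, factors of the small algebra are absorbed by
  \<open>last_left_emb\<close> until a root ending in \<open>Last\<close> is met; whatever stands to
  its left is a coefficient.\<close>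

lemma raising_last_left:
  "set \<gamma>s \<subseteq> pos_roots \<Longrightarrow> \<exists>\<gamma>\<in>set \<gamma>s. snd \<gamma> = Last \<Longrightarrow> raising \<gamma>s \<in> last_left"
proof (induction \<gamma>s rule: rev_induct)
  case (snoc \<gamma> \<gamma>s)
  obtain i j where \<gamma>: "\<gamma> = (i, j)" "i < j"
    using snoc.prems(1) by (cases \<gamma>) (auto simp: pos_roots_def)
  show ?case
  proof (cases j)
    case Last
    with \<gamma> show ?thesis
      by (auto simp: raising_snoc less_Last_iff intro: last_left_left last_left_e_diag)
  next
    case (Old j')
    with \<gamma> snoc obtain i' where "i = Old i'" "raising \<gamma>s \<in> last_left"
      by (auto simp: less_Old_iff)
    with \<gamma> Old show ?thesis
      by (simp add: raising_snoc last_left_emb flip: emb_e)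
  qed
qed simp

text \<open>The same absorption, read from the left.\<close>

lemma lowering_last_right:
  "set \<gamma>s \<subseteq> pos_roots \<Longrightarrow> \<exists>\<gamma>\<in>set \<gamma>s. snd \<gamma> = Last \<Longrightarrow> lowering \<gamma>s \<in> last_right"
proof (induction \<gamma>s)
  case (Cons \<gamma> \<gamma>s)
  obtain i j where \<gamma>: "\<gamma> = (i, j)" "i < j"
    using Cons.prems(1) by (cases \<gamma>) (auto simp: pos_roots_def)
  show ?case
  proof (cases j)
    case Last
    with \<gamma> show ?thesis
      by (auto simp: lowering_Cons less_Last_iff intro: last_right_right last_right_e_diag)
  next
    case (Old j')
    with \<gamma> Cons obtain i' where "i = Old i'" "lowering \<gamma>s \<in> last_right"
      by (auto simp: less_Old_iff)
    with \<gamma> Old show ?thesis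
      by (simp add: lowering_Cons last_right_emb flip: emb_e)
  qed
qed simp

text \<open>The largest index is never the first index of a positive root, so its coordinate
  receives negative contributions only.\<close>

lemma weight_at_Last:
  "set \<gamma>s \<subseteq> pos_roots \<Longrightarrow> weight \<gamma>s Last = - int (length (filter (\<lambda>\<gamma>. snd \<gamma> = Last) \<gamma>s))"
  by (induction \<gamma>s) (auto simp: weight_Cons pos_roots_def, simp add: weight_def)

text \<open>Comparing weights at \<open>Last\<close> shows that new roots occur in both monomials or
  in neither. In the first case the term lies in both ideals; in the second all its roots are old
  and \<open>0 < d\<close> supplies the outer factors.\<close>

lemma zero_weight_terms_plus1:
  assumes "t \<in> zero_weight_terms d" "0 < d"
  shows "t \<in> last_left \<and> t \<in> last_right \<or>
    (\<exists>i j c. i < j \<and> t = e_diag (Old j) (Old i) * c) \<and>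
    (\<exists>i j c. i < j \<and> t = c * e_diag (Old i) (Old j))"
proof -
  obtain \<xi> \<gamma>s \<gamma>s' where t: "t = \<xi> * lowering \<gamma>s * raising \<gamma>s'" "\<xi> \<in> Uh"
      "set \<gamma>s \<subseteq> pos_roots" "set \<gamma>s' \<subseteq> pos_roots" "weight \<gamma>s = weight \<gamma>s'" "length \<gamma>s' = d"
    using assms(1) by (auto simp: zero_weight_terms_def)
  have "length (filter (\<lambda>\<gamma>. snd \<gamma> = Last) \<gamma>s) = length (filter (\<lambda>\<gamma>. snd \<gamma> = Last) \<gamma>s')"
    using weight_at_Last[OF t(3)] weight_at_Last[OF t(4)] t(5) by simp
  then have Last: "(\<exists>\<gamma>\<in>set \<gamma>s. snd \<gamma> = Last) \<longleftrightarrow> (\<exists>\<gamma>\<in>set \<gamma>s'. snd \<gamma> = Last)"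
    by (metis (mono_tags, lifting) filter_empty_conv length_0_conv)
  show ?thesis
  proof (cases "\<exists>\<gamma>\<in>set \<gamma>s'. snd \<gamma> = Last")
    case True
    have "t \<in> last_left"
      unfolding t(1) using t(4) True by (intro last_left_left raising_last_left)
    \<comment> \<open>The coefficient is moved behind the lowering monomial, where the right ideal
      absorbs it.\<close>
    moreover obtain \<xi>' where "\<xi> * lowering \<gamma>s = lowering \<gamma>s * \<xi>'"
      using has_weight_Uh_right[OF has_weight_lowering t(2)] by blast
    then have "t \<in> last_right"
      unfolding t(1) using t(3) True Last by (auto intro!: last_right_right lowering_last_right)
    ultimately show ?thesis by blast
  next
    case False
    have old: "\<exists>i' j'. i = Old i' \<and> j = Old j' \<and> i' < j'"
      if "(i, j) \<in> set \<gamma>s \<union> set \<gamma>s'" for i j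
    proof -
      have "i < j" "j \<noteq> Last"
        using that t(3,4) False Last by (auto simp: pos_roots_def)
      then show ?thesis
        by (cases j) (auto simp: less_Old_iff)
    qed
    have "\<gamma>s' \<noteq> []"
      using t(6) assms(2) by auto
    from zero_weight_term_factors[OF t(2,4,5) this] old show ?thesis
      unfolding t(1) by blast
  qed
qed

section \<open>The one-sided ideals\<close>

lemma subspace_left_ideal: "abar.subspace {x. to_dra x \<in> left_ideal m G}"
  and subspace_right_ideal: "abar.subspace {x. to_dra x \<in> right_ideal m G}"
  unfolding abar.subspace_def
  by (auto simp: to_dra_add to_dra_scale to_dra_zero intro: left_ideal.intros right_ideal.intros)

lemma left_ideal_diff: "x \<in> left_ideal m G \<Longrightarrow> y \<in> left_ideal m G \<Longrightarrow> x - y \<in> left_ideal m G"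
  using left_ideal.add[of x m G "- y"] left_ideal.scale[of y m G "-1"] by simp

lemma right_ideal_diff: "x \<in> right_ideal m G \<Longrightarrow> y \<in> right_ideal m G \<Longrightarrow> x - y \<in> right_ideal m G"
  using right_ideal.add[of x m G "- y"] right_ideal.scale[of y m G "-1"] by simp

lemma coset_left_ideal: "x \<in> coset_space \<Longrightarrow> to_dra x \<in> left_ideal m G"
  and coset_right_ideal: "x \<in> coset_space \<Longrightarrow> to_dra x \<in> right_ideal m G"
  by (metis to_dra_eq_0_iff left_ideal.zero, metis to_dra_eq_0_iff right_ideal.zero)

text \<open>In \<open>a P E\<^sub>k\<^sub>,\<^sub>n\<^sub>+\<^sub>1\<close> every non-constant term of \<open>P\<close> replaces \<open>k\<close> by a smaller index,
  modulo the cosets divided out.\<close>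

lemma E_diff_left_ideal:
  fixes P' :: "nat \<Rightarrow> 'n::{finite,linorder} plus1 abar"
  assumes "extremal_projector P'"
  shows "to_dra (a * E_diff (Old k) Last) \<in> left_ideal (diamond P') {z_gen (Old i) Last |i. True}"
    (is "_ \<in> ?V")
proof (induction "card {..<k}" arbitrary: a k rule: less_induct)
  case less
  let ?E = "E_diff (Old k) Last :: 'n plus1 abar"
  have "\<forall>\<^sub>F M in sequentially. 0 < M \<and> to_dra (a * psum P' M * ?E) = diamond P' (to_dra a) (to_dra ?E)"
    using eventually_gt_at_top diamond_to_dra[OF assms] by (rule eventually_conj)
  then obtain M where M: "0 < M" "to_dra (a * psum P' M * ?E) = diamond P' (to_dra a) (to_dra ?E)"
    using eventually_happens trivial_limit_sequentially by blast
  have "diamond P' (to_dra a) (to_dra ?E) \<in> ?V"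
    by (rule left_ideal.mult, rule left_ideal.base) (auto simp: z_gen_def)
  moreover have "to_dra (a * (psum P' M - 1) * ?E) \<in> ?V"
    using psum_minus_one[OF assms M(1) zero_weight_terms_end]
      subspace_vimage_mult[OF subspace_left_ideal]
  proof (rule span_subspace_induct)
    fix s :: "'n plus1 abar" assume "s \<in> {c * e_diag i j |i j c. i < j}"
    then obtain i j c where s: "s = c * e_diag i j" "i < j" by blast
    have coset: "a * c * ?E * e_diag i j \<in> coset_space"
      using e_diag_n_plus[OF s(2)] by (rule coset_space_right)
    have "to_dra (a * c * E_diff i Last) \<in> ?V" if j: "j = Old k"
    proof -
      obtain k' where k': "i = Old k'" "k' < k"
        using s(2) j by (auto simp: less_Old_iff)
      then have "card {..<k'} < card {..<k}"
        by (intro psubset_card_mono) auto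
      with less k'(1) show ?thesis by blast
    qed
    \<comment> \<open>The other commutator term would require \<open>i = Last\<close>, which
      \<open>i < j\<close> excludes.\<close>
    moreover have "a * s * ?E = a * c * ?E * e_diag i j + (if j = Old k then a * c * E_diff i Last else 0)"
      using s(2) by (auto simp: s(1) mult.assoc adjoint_familyD[OF adjoint_family_E_diff] distrib_left)
    ultimately show "to_dra (a * s * ?E) \<in> ?V"
      using coset_left_ideal[OF coset] by (auto simp: to_dra_add to_dra_zero intro: left_ideal.add)
  qed
  ultimately have "to_dra (a * psum P' M * ?E - a * (psum P' M - 1) * ?E) \<in> ?V"
    unfolding to_dra_diff M(2) by (rule left_ideal_diff)
  then show ?case
    by (simp add: left_diff_distrib right_diff_distrib)
qed

text \<open>In \<open>E_{n+1,k} P a\<close> the leading lowering factor of a non-constant term is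
  commuted to the far left, where it is divided out. The commutator replaces \<open>k\<close> by a
  smaller index, which the induction covers.\<close>

lemma E_diff_right_ideal:
  fixes P' :: "nat \<Rightarrow> 'n::{finite,linorder} plus1 abar"
  assumes "extremal_projector P'"
  shows "to_dra (E_diff Last (Old k) * a) \<in> right_ideal (diamond P') {z_gen Last (Old i) |i. True}"
    (is "_ \<in> ?V")
proof (induction "card {..<k}" arbitrary: a k rule: less_induct)
  case less
  let ?E = "E_diff Last (Old k) :: 'n plus1 abar"
  have "\<forall>\<^sub>F M in sequentially. 0 < M \<and> to_dra (?E * psum P' M * a) = diamond P' (to_dra ?E) (to_dra a)"
    using eventually_gt_at_top diamond_to_dra[OF assms] by (rule eventually_conj)
  then obtain M where M: "0 < M" "to_dra (?E * psum P' M * a) = diamond P' (to_dra ?E) (to_dra a)"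
    using eventually_happens trivial_limit_sequentially by blast
  have "diamond P' (to_dra ?E) (to_dra a) \<in> ?V"
    by (rule right_ideal.mult, rule right_ideal.base) (auto simp: z_gen_def)
  moreover have "to_dra (?E * (psum P' M - 1) * a) \<in> ?V"
    using psum_minus_one[OF assms M(1) zero_weight_terms_start]
      subspace_vimage_mult[OF subspace_right_ideal]
  proof (rule span_subspace_induct)
    fix s :: "'n plus1 abar" assume "s \<in> {e_diag j i * c |i j c. i < j}"
    then obtain i j c where s: "s = e_diag j i * c" "i < j" by blast
    have coset: "e_diag j i * (?E * c * a) \<in> coset_space"
      using e_diag_n_minus[OF s(2)] by (rule coset_space_left)
    have smaller: "to_dra (E_diff Last i * (c * a)) \<in> ?V" if j: "j = Old k"
    proof -
      obtain k' where k': "i = Old k'" "k' < k"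
        using s(2) j by (auto simp: less_Old_iff)
      then have "card {..<k'} < card {..<k}"
        by (intro psubset_card_mono) auto
      with less k'(1) show ?thesis by blast
    qed
    have "?E * e_diag j i = e_diag j i * ?E + (if j = Old k then E_diff Last i else 0)"
      using s(2) by (auto simp: adjoint_familyD[OF adjoint_family_E_diff])
    then have "?E * e_diag j i * (c * a) =
        (e_diag j i * ?E + (if j = Old k then E_diff Last i else 0)) * (c * a)"
      by simp
    then have "?E * s * a = e_diag j i * (?E * c * a) + (if j = Old k then E_diff Last i * (c * a) else 0)"
      by (simp add: s(1) mult.assoc distrib_right)
    with smaller show "to_dra (?E * s * a) \<in> ?V"
      using coset_right_ideal[OF coset] by (auto simp: to_dra_add to_dra_zero intro: right_ideal.add)
  qed
  ultimately have "to_dra (?E * psum P' M * a - ?E * (psum P' M - 1) * a) \<in> ?V"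
    unfolding to_dra_diff M(2) by (rule right_ideal_diff)
  then show ?case
    by (simp add: left_diff_distrib right_diff_distrib)
qed

lemma E1_eq: "E1 i j = scaleA (1/2) (e_diag i j + E_diff i j)"
  and E2_eq: "E2 i j = scaleA (1/2) (e_diag i j - E_diff i j)"
proof -
  have "e_diag i j + E_diff i j = scaleA (1 + 1) (E1 i j)" "e_diag i j - E_diff i j = scaleA (1 + 1) (E2 i j)"
    unfolding abar.scale_left_distrib by (simp_all add: e_diag_def E_diff_def)
  then show "E1 i j = scaleA (1/2) (e_diag i j + E_diff i j)"
      "E2 i j = scaleA (1/2) (e_diag i j - E_diff i j)"
    by simp_all
qed

text \<open>A matrix unit of either copy is half the sum or difference of \<open>e_diag\<close> and
  \<open>E_diff\<close>. The first part lies in the left ideal generated by \<open>n_plus\<close>,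
  and the second is covered by \<open>E_diff_left_ideal\<close>.\<close>

lemma last_left_left_ideal:
  fixes P' :: "nat \<Rightarrow> 'n::{finite,linorder} plus1 abar"
  assumes "extremal_projector P'" "x \<in> last_left"
  shows "to_dra x \<in> left_ideal (diamond P') {z_gen (Old i) Last |i. True}" (is "_ \<in> ?V")
  using assms(2)[unfolded last_left_def] subspace_left_ideal
proof (rule span_subspace_induct)
  fix s :: "'n plus1 abar" assume "s \<in> {a * F (Old k) Last |a F k. F \<in> {E1, E2}}"
  then obtain a F k where s: "s = a * F (Old k) Last" "F \<in> {E1, E2}" by blast
  have "to_dra (a * e_diag (Old k) Last) \<in> ?V"
    by (intro coset_left_ideal coset_space_right e_diag_n_plus Old_less_Last)
  then have "to_dra (a * (e_diag (Old k) Last + E_diff (Old k) Last)) \<in> ?V"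
      "to_dra (a * (e_diag (Old k) Last - E_diff (Old k) Last)) \<in> ?V"
    using E_diff_left_ideal[OF assms(1), of a k]
    by (simp_all add: distrib_left right_diff_distrib to_dra_add to_dra_diff left_ideal.add left_ideal_diff)
  with s show "to_dra s \<in> ?V"
    by (auto simp: E1_eq E2_eq to_dra_scale intro: left_ideal.scale)
qed

text \<open>The same splitting, with \<open>e_diag Last (Old k)\<close> divided out through
  \<open>n_minus\<close>.\<close>

lemma last_right_right_ideal:
  fixes P' :: "nat \<Rightarrow> 'n::{finite,linorder} plus1 abar"
  assumes "extremal_projector P'" "x \<in> last_right"
  shows "to_dra x \<in> right_ideal (diamond P') {z_gen Last (Old i) |i. True}" (is "_ \<in> ?V")
  using assms(2)[unfolded last_right_def] subspace_right_ideal
proof (rule span_subspace_induct)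
  fix s :: "'n plus1 abar" assume "s \<in> {F Last (Old k) * a |a F k. F \<in> {E1, E2}}"
  then obtain a F k where s: "s = F Last (Old k) * a" "F \<in> {E1, E2}" by blast
  have "to_dra (e_diag Last (Old k) * a) \<in> ?V"
    by (intro coset_right_ideal coset_space_left e_diag_n_minus Old_less_Last)
  then have "to_dra ((e_diag Last (Old k) + E_diff Last (Old k)) * a) \<in> ?V"
      "to_dra ((e_diag Last (Old k) - E_diff Last (Old k)) * a) \<in> ?V"
    using E_diff_right_ideal[OF assms(1), of k a]
    by (simp_all add: distrib_right left_diff_distrib to_dra_add to_dra_diff right_ideal.add right_ideal_diff)
  with s show "to_dra s \<in> ?V"
    by (auto simp: E1_eq E2_eq to_dra_scale intro: right_ideal.scale)
qed

section \<open>Comparison of the two products\<close>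

lemma emb_start: "x \<in> abar.span {e_diag j i * c |i j c. i < j} \<Longrightarrow>
    emb x \<in> abar.span {e_diag (Old j) (Old i) * c |i j c. i < j}"
  by (erule emb_span, rule abar.span_base) (clarsimp simp: emb_mult emb_e, blast)

lemma emb_end: "x \<in> abar.span {c * e_diag i j |i j c. i < j} \<Longrightarrow>
    emb x \<in> abar.span {c * e_diag (Old i) (Old j) |i j c. i < j}"
  by (erule emb_span, rule abar.span_base) (clarsimp simp: emb_mult emb_e, blast)

text \<open>One threshold serves all root vectors, because the index type is finite, and all left
  factors \<open>u\<close>, because power ideals are left ideals. The factor \<open>u\<close> will
  come from a truncation of the other projector, whose length is not yet fixed.\<close>

lemma eventually_annihilated:
  fixes s :: "nat \<Rightarrow> 'n::{finite,linorder} plus1 abar"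
  assumes "\<And>i j. i < j \<Longrightarrow> tends_to_zero (\<lambda>M. e_diag (Old i) (Old j) * s M)"
  shows "\<forall>\<^sub>F M in sequentially. \<forall>i j u. i < j \<longrightarrow>
    u * (e_diag (Old i) (Old j) * s M * b) \<in> nplus_power_ideal 1"
proof -
  have "\<forall>\<^sub>F M in sequentially. i < j \<longrightarrow>
      1 * (e_diag (Old i) (Old j) * s M) * b \<in> nplus_power_ideal 1" for i j
    using tends_to_zero_mult[OF assms, of i j 1 b] by (cases "i < j") simp_all
  then have "\<forall>\<^sub>F M in sequentially. \<forall>i j. i < j \<longrightarrow>
      1 * (e_diag (Old i) (Old j) * s M) * b \<in> nplus_power_ideal 1"
    by (intro eventually_all_finite)
  then show ?thesis
    by (rule eventually_mono) (use nplus_power_ideal_left in fastforce)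
qed

text \<open>With truncations \<open>p\<close> and \<open>p'\<close>, the identity
  \<open>p' - p = p (p' - 1) - (p - 1) p'\<close> isolates two errors: the second has class zero by
  \<open>n_+ P' = 0\<close>, the first lies in the left ideal up to terms removed by
  \<open>P n_- = 0\<close>.\<close>

lemma diamond_minus_left_ideal:
  fixes P :: "nat \<Rightarrow> 'n::{finite,linorder} abar" and P' :: "nat \<Rightarrow> 'n plus1 abar"
  assumes "extremal_projector P" "extremal_projector P'"
  shows "\<forall>\<^sub>F M in sequentially. diamond P' (to_dra a) (to_dra (emb b)) - to_dra (a * emb (psum P M) * emb b)
    \<in> left_ideal (diamond P') {z_gen (Old i) Last |i. True}" (is "\<forall>\<^sub>F M in _. _ \<in> ?V")
proof -
  have "\<forall>\<^sub>F M in sequentially. \<forall>i j u. i < j \<longrightarrow>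
      u * (e_diag (Old i) (Old j) * psum P' M * emb b) \<in> nplus_power_ideal 1"
    using assms(2) by (intro eventually_annihilated) (simp add: extremal_projector_def e_diag_n_plus)
  then have "\<forall>\<^sub>F M in sequentially. 0 < M \<and>
      to_dra (a * psum P' M * emb b) = diamond P' (to_dra a) (to_dra (emb b)) \<and>
      (\<forall>i j u. i < j \<longrightarrow> u * (e_diag (Old i) (Old j) * psum P' M * emb b) \<in> nplus_power_ideal 1)"
    by (intro eventually_conj eventually_gt_at_top diamond_to_dra[OF assms(2)])
  \<comment> \<open>The index \<open>M'\<close> is fixed before \<open>M\<close>; its last property
    holds for every \<open>u\<close> and so covers the coefficients of all truncations of
    \<open>P\<close>.\<close>
  then obtain M' where M': "0 < M'"
      "to_dra (a * psum P' M' * emb b) = diamond P' (to_dra a) (to_dra (emb b))"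
      "\<And>i j u. i < j \<Longrightarrow> u * (e_diag (Old i) (Old j) * psum P' M' * emb b) \<in> nplus_power_ideal 1"
    using eventually_happens trivial_limit_sequentially by blast
  let ?p' = "psum P' M'"
  \<comment> \<open>The truncated form of \<open>P P' = P'\<close>, valid for every positive
    \<open>M\<close>.\<close>
  have absorb: "to_dra (a * emb (psum P M - 1) * (?p' * emb b)) \<in> ?V" if "0 < M" for M
    using emb_end[OF psum_minus_one[OF assms(1) that zero_weight_terms_end]]
      subspace_vimage_mult[OF subspace_left_ideal]
  proof (rule span_subspace_induct)
    fix s :: "'n plus1 abar" assume "s \<in> {c * e_diag (Old i) (Old j) |i j c. i < j}"
    then obtain i j c where s: "s = c * e_diag (Old i) (Old j)" "i < j" by blast
    show "to_dra (a * s * (?p' * emb b)) \<in> ?V"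
      using coset_left_ideal[OF nplus_power_ideal_1[OF M'(3)[OF s(2), of "a * c"]]]
      by (simp add: s(1) mult.assoc)
  qed
  \<comment> \<open>As \<open>p' - 1\<close> is now a fixed element, it is a finite combination of
    such terms. Those in \<open>L\<close> stay there between the outer factors; each of the others
    is annihilated by \<open>P\<close> for all large \<open>M\<close>.\<close>
  have shape: "zero_weight_terms d \<subseteq> last_left \<union> {e_diag (Old j) (Old i) * c |i j c. i < j}"
    if "0 < d" for d
    using zero_weight_terms_plus1[OF _ that] by blast
  have "\<forall>\<^sub>F M in sequentially. to_dra (a * emb (psum P M) * t * emb b) \<in> ?V"
    if "t \<in> abar.span (last_left \<union> {e_diag (Old j) (Old i) * c |i j c. i < j})" for t
    using that
  proof (induction rule: abar.span_induct_alt)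
    case base
    then show ?case
      by (simp add: to_dra_zero left_ideal.zero)
  next
    case (step k x y)
    have "\<forall>\<^sub>F M in sequentially. to_dra (a * emb (psum P M) * x * emb b) \<in> ?V"
      using step(1)
    proof (elim UnE CollectE exE conjE)
      assume "x \<in> last_left"
      then show ?thesis
        by (intro always_eventually allI last_left_left_ideal[OF assms(2)] last_left_emb last_left_left)
    next
      fix i j c assume x: "x = e_diag (Old j) (Old i) * c" "i < j"
      have "tends_to_zero (\<lambda>M. emb (psum P M * e_diag j i))"
        using assms(1) e_diag_n_minus[OF x(2)]
        by (intro emb_tends_to_zero) (simp add: extremal_projector_def)
      from tends_to_zero_mult[OF this, of a "c * emb b"] show ?thesis
      proof eventually_elim
        case (elim M)
        from coset_left_ideal[OF nplus_power_ideal_1[OF this]] show ?case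
          by (simp add: x(1) emb_mult emb_e mult.assoc)
      qed
    qed
    with step(2) show ?case
      by eventually_elim
         (simp add: distrib_left distrib_right to_dra_add to_dra_scale left_ideal.add left_ideal.scale)
  qed
  then have "\<forall>\<^sub>F M in sequentially. to_dra (a * emb (psum P M) * (?p' - 1) * emb b) \<in> ?V"
    using psum_minus_one[OF assms(2) M'(1) shape] by blast
  from this eventually_gt_at_top[of 0] show ?thesis
  proof eventually_elim
    case (elim M)
    have "a * ?p' * emb b - a * emb (psum P M) * emb b = a * emb (psum P M) * (?p' - 1) * emb b
        - a * emb (psum P M - 1) * (?p' * emb b)"
      by (simp add: emb_diff algebra_simps)
    moreover have "to_dra (a * emb (psum P M) * (?p' - 1) * emb b
        - a * emb (psum P M - 1) * (?p' * emb b)) \<in> ?V"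
      unfolding to_dra_diff using elim(1) absorb[OF elim(2)] by (rule left_ideal_diff)
    ultimately have "to_dra (a * ?p' * emb b - a * emb (psum P M) * emb b) \<in> ?V"
      by (simp only:)
    then show ?case
      by (simp only: to_dra_diff M'(2))
  qed
qed

text \<open>The mirror identity is \<open>p' - p = (p' - 1) p - p' (p - 1)\<close>. The order of
  choices is reversed: \<open>M\<close> is fixed first, and \<open>M'\<close> may depend on
  it.\<close>

lemma diamond_minus_right_ideal:
  fixes P :: "nat \<Rightarrow> 'n::{finite,linorder} abar" and P' :: "nat \<Rightarrow> 'n plus1 abar"
  assumes "extremal_projector P" "extremal_projector P'"
  shows "\<forall>\<^sub>F M in sequentially. diamond P' (to_dra (emb a)) (to_dra b) - to_dra (emb a * emb (psum P M) * b)
    \<in> right_ideal (diamond P') {z_gen Last (Old i) |i. True}" (is "\<forall>\<^sub>F M in _. _ \<in> ?V")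
proof -
  have "tends_to_zero (\<lambda>M. e_diag (Old i) (Old j) * emb (psum P M))" if "i < j" for i j
  proof -
    have "tends_to_zero (\<lambda>M. emb (e_diag i j * psum P M))"
      using assms(1) e_diag_n_plus[OF that]
      by (intro emb_tends_to_zero) (simp add: extremal_projector_def)
    then show ?thesis
      by (simp add: emb_mult emb_e)
  qed
  then have "\<forall>\<^sub>F M in sequentially. \<forall>i j u. i < j \<longrightarrow>
      u * (e_diag (Old i) (Old j) * emb (psum P M) * b) \<in> nplus_power_ideal 1"
    by (rule eventually_annihilated)
  from this eventually_gt_at_top[of 0] show ?thesis
  proof eventually_elim
    case (elim M)
    let ?p = "emb (psum P M)"
    \<comment> \<open>The truncated form of \<open>P' P = P'\<close>: for fixed \<open>M\<close> the
      finitely many terms of \<open>p - 1\<close> start with old lowering operators, which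
      \<open>P'\<close> eventually annihilates.\<close>
    have absorb: "\<forall>\<^sub>F M' in sequentially. emb a * psum P' M' * t * b \<in> coset_space"
      if "t \<in> abar.span {e_diag (Old j) (Old i) * c |i j c. i < j}" for t
      using that
    proof (induction rule: abar.span_induct_alt)
      case base
      then show ?case
        by (simp add: abar.subspace_0[OF subspace_coset_space])
    next
      case (step k x y)
      from step(1) obtain i j c where x: "x = e_diag (Old j) (Old i) * c" "i < j" by blast
      have "tends_to_zero (\<lambda>M'. psum P' M' * e_diag (Old j) (Old i))"
        using assms(2) x(2) by (simp add: extremal_projector_def e_diag_n_minus)
      from tends_to_zero_mult[OF this, of "emb a" "c * b"]
      have "\<forall>\<^sub>F M' in sequentially. emb a * psum P' M' * x * b \<in> coset_space"
      proof eventually_elim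
        case (elim M')
        from nplus_power_ideal_1[OF this] show ?case
          by (simp add: x(1) mult.assoc)
      qed
      with step(2) show ?case
        by eventually_elim
           (simp add: distrib_left distrib_right abar.subspace_add[OF subspace_coset_space]
             abar.subspace_scale[OF subspace_coset_space])
    qed
    have "\<forall>\<^sub>F M' in sequentially. 0 < M' \<and>
        to_dra (emb a * psum P' M' * b) = diamond P' (to_dra (emb a)) (to_dra b) \<and>
        emb a * psum P' M' * emb (psum P M - 1) * b \<in> coset_space"
      by (intro eventually_conj eventually_gt_at_top diamond_to_dra[OF assms(2)] absorb emb_start
          psum_minus_one[OF assms(1) elim(2) zero_weight_terms_start])
    then obtain M' where M': "0 < M'"
        "to_dra (emb a * psum P' M' * b) = diamond P' (to_dra (emb a)) (to_dra b)"
        "emb a * psum P' M' * emb (psum P M - 1) * b \<in> coset_space"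
      using eventually_happens trivial_limit_sequentially by blast
    let ?p' = "psum P' M'"
    have shape: "zero_weight_terms d \<subseteq> last_right \<union> {c * e_diag (Old i) (Old j) |i j c. i < j}"
      if "0 < d" for d
      using zero_weight_terms_plus1[OF _ that] by blast
    have "to_dra (emb a * (?p' - 1) * (?p * b)) \<in> ?V"
      using psum_minus_one[OF assms(2) M'(1) shape] subspace_vimage_mult[OF subspace_right_ideal]
    proof (rule span_subspace_induct)
      fix s :: "'n plus1 abar" assume "s \<in> last_right \<union> {c * e_diag (Old i) (Old j) |i j c. i < j}"
      then show "to_dra (emb a * s * (?p * b)) \<in> ?V"
      proof (elim UnE CollectE exE conjE)
        assume "s \<in> last_right"
        then show ?thesis
          by (intro last_right_right_ideal[OF assms(2)] last_right_emb last_right_right)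
      next
        fix i j c assume s: "s = c * e_diag (Old i) (Old j)" "i < j"
        \<comment> \<open>The estimate for \<open>M\<close> is uniform in the left factor, so it
          applies to \<open>emb a * c\<close> although \<open>c\<close> comes from the later choice
          of \<open>M'\<close>.\<close>
        from elim(1) s(2) have "(emb a * c) * (e_diag (Old i) (Old j) * ?p * b) \<in> nplus_power_ideal 1"
          by blast
        from coset_right_ideal[OF nplus_power_ideal_1[OF this]] show ?thesis
          by (simp add: s(1) mult.assoc)
      qed
    qed
    moreover have "to_dra (emb a * ?p' * emb (psum P M - 1) * b) \<in> ?V"
      using M'(3) by (rule coset_right_ideal)
    ultimately have "to_dra (emb a * (?p' - 1) * (?p * b) - emb a * ?p' * emb (psum P M - 1) * b) \<in> ?V"
      unfolding to_dra_diff by (rule right_ideal_diff)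
    moreover have "emb a * ?p' * b - emb a * ?p * b =
        emb a * (?p' - 1) * (?p * b) - emb a * ?p' * emb (psum P M - 1) * b"
      by (simp add: emb_diff algebra_simps)
    ultimately have "to_dra (emb a * ?p' * b - emb a * ?p * b) \<in> ?V"
      by (simp only:)
    then show ?case
      by (simp only: to_dra_diff M'(2))
  qed
qed

section \<open>Passage from the ideals to the projection \<open>\<pi>\<close>\<close>

theorem proposition4:
  fixes P :: "nat \<Rightarrow> 'n::{finite,linorder} abar"
    and P' :: "nat \<Rightarrow> 'n plus1 abar"
    and \<pi> :: "'n plus1 dra \<Rightarrow> 'n plus1 dra"
    and x y :: "'n dra"
  assumes "extremal_projector P" and "extremal_projector P'"
    and "Vector_Spaces.linear scaleZ scaleZ \<pi>"
    and "range \<pi> = range iota" and "\<forall>u \<in> range iota. \<pi> u = u"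
    and "(\<forall>v \<in> left_ideal (diamond P') {z_gen (Old i) Last |i. True}. \<pi> v = 0) \<or>
         (\<forall>v \<in> right_ideal (diamond P') {z_gen Last (Old i) |i. True}. \<pi> v = 0)"
  shows "iota (diamond P x y) = \<pi> (diamond P' (iota x) (iota y))"
proof -
  obtain a b where xy: "x = to_dra a" "y = to_dra b"
    by (metis to_dra_cases)
  let ?d = "\<lambda>M. diamond P' (iota x) (iota y) - to_dra (emb a * emb (psum P M) * emb b)"
  have "\<forall>\<^sub>F M in sequentially. \<pi> (?d M) = 0"
    using assms(6)
  proof
    assume "\<forall>v \<in> left_ideal (diamond P') {z_gen (Old i) Last |i. True}. \<pi> v = 0"
    then show ?thesis
      unfolding xy iota_to_dra
      by (intro eventually_mono[OF diamond_minus_left_ideal[OF assms(1,2)]]) blast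
  next
    assume "\<forall>v \<in> right_ideal (diamond P') {z_gen Last (Old i) |i. True}. \<pi> v = 0"
    then show ?thesis
      unfolding xy iota_to_dra
      by (intro eventually_mono[OF diamond_minus_right_ideal[OF assms(1,2)]]) blast
  qed
  moreover have "\<forall>\<^sub>F M in sequentially. to_dra (a * psum P M * b) = diamond P x y"
    unfolding xy by (rule diamond_to_dra[OF assms(1)])
  ultimately have "\<forall>\<^sub>F M in sequentially. \<pi> (?d M) = 0 \<and> to_dra (a * psum P M * b) = diamond P x y"
    by (rule eventually_conj)
  then obtain M where M: "\<pi> (?d M) = 0" "to_dra (a * psum P M * b) = diamond P x y"
    using eventually_happens trivial_limit_sequentially by blast
  interpret \<pi>: Vector_Spaces.linear scaleZ scaleZ \<pi>
    by (rule assms(3))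
  \<comment> \<open>At one fixed large \<open>M\<close> the product is an element of the algebra, so
    the homomorphism \<open>emb\<close> applies to it; its class is in the image of
    \<open>iota\<close> and is fixed by \<open>\<pi>\<close>.\<close>
  have "to_dra (emb a * emb (psum P M) * emb b) = iota (diamond P x y)"
    by (simp flip: M(2) emb_mult add: iota_to_dra)
  with M(1) have "\<pi> (diamond P' (iota x) (iota y)) = \<pi> (iota (diamond P x y))"
    by (simp add: \<pi>.diff)
  with assms(5) show ?thesis by simp
qed

end
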